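(* Let $(J,K,\tau_0,V,W,\tau_1,R,S)$ be data as described in the context, with associated skew pairing $\tau$, generalized $q$-boson algebra $\mathcal{B}$, smash product $\mathcal{A}\#\mathcal{H}$ with its representation $\varpi$ on $\mathcal{A}$, and subalgebra $R\#S\subset\mathcal{A}\#\mathcal{H}$. (1) The inclusions $R,S\hookrightarrow R\#S$ uniquely extend to an algebra isomorphism $\mathcal{B}\xrightarrow{\simeq}R\#S$. (2) A linear representation $\rho:R\#S\to\mathrm{End}(R)$ of $R\#S$ on $R$ is induced from $\varpi$ so that $$\rho(r\#s)(r')=r(s\triangleright r')\quad(r,r'\in R,\ s\in S).$$
   Context: Let $k$ be a field of arbitrary characteristic; everything is over $k$, and gradings are by $\mathbb{N}=\{0,1,2,\dots\}$ unless otherwise stated. For a Hopf algebra $J$ with bijective antipode $\mathcal{S}$, write $\Delta(a)=a_1\otimes a_2$. ${}_J^J\mathcal{YD}$ is the braided tensor category of Yetter–Drinfeld modules over $J$: left $J$-modules $V$ (action $a\rightharpoonup v$) with a left $J$-comodule structure $v\mapsto v_J\otimes v_V$ such that $a\rightharpoonup v\mapsto a_1v_J\mathcal{S}(a_3)\otimes(a_2\rightharpoonup v_V)$; the braiding is $c(v\otimes w)=(v_J\rightharpoonup w)\otimes v_V$. The tensor algebra $T(V)$ is a braided graded Hopf algebra in ${}_J^J\mathcal{YD}$ in which elements of $V$ are primitive. A pre-Nichols algebra of $V$ is a quotient $R=T(V)/I=\bigoplus_{n\ge 0}R(n)$ by a homogeneous bi-ideal $I$ in ${}_J^J\mathcal{YD}$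 with $I\cap V=0$ (equivalently, a braided graded bialgebra with $R(0)=k$, $R(1)=V$, generated by $R(1)$). The coproduct of $R$ is written $\Delta_R(r)=r_{(1)}\otimes r_{(2)}$. The bosonization $R\rtimes J$ (Radford biproduct) is the Hopf algebra on $R\otimes J$ (write $ra=r\otimes a$) with $(ra)(sb)=r(a_1\rightharpoonup s)(a_2b)$ and $\Delta(ra)=r_{(1)}(r_{(2)J}a_1)\otimes r_{(2)R}a_2$. A skew pairing of Hopf algebras $A,X$ (with bijective antipodes) is a linear form $\tau:A\otimes X\to k$ with $\tau(ab,x)=\tau(a,x_1)\tau(b,x_2)$, $\tau(a,xy)=\tau(a_1,y)\tau(a_2,x)$, $\tau(1,x)=\varepsilon(x)$, $\tau(a,1)=\varepsilon(a)$. Data: $J,K$ are Hopf algebras with bijective antipodes; $\tau_0:J\otimes K\to k$ is a skew pairing; $V\in{}_J^J\mathcal{YD}$, $W\in{}_K^K\mathcal{YD}$; $\tau_1:V\otimes W\to k$ is a linear form with $\tau_1(a\rightharpoonup v,w)=\tau_0(a,w_K)\tau_1(v,w_W)$ and $\tau_1(v,x\rightharpoonup w)=\tau_0(v_J,\mathcal{S}(x))\tau_1(v_V,w)$ for all $a\in J,x\in K,v\in V,w\in W$; $R,S$ are pre-Nichols algebras of $V,W$ respectively. Then $\tau_0,\tau_1$ extend uniquely to a skew pairing $\tau:(R\rtimes J)\otimes(S\rtimes K)\to k$ with $\tau(a,w)=0=\tau(v,x)$ for $a\in J$, $x\in K$, $v\in V$, $w\in W$. The generalized $q$-boson algebra $\mathcal{B}$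 is the unique algebra structure on the vector space $R\otimes S$ with unit $1\otimes 1$ that includes $R=R\otimes k$ and $S=k\otimes S$ as subalgebras and satisfies $rs=r\otimes s$ ($r\in R,s\in S$) and $wv=\tau_0(v_J,w_K)\,v_V\otimes w_W+\tau_1(v,w)\,1\otimes 1$ ($v\in V,w\in W$). Set $\mathcal{A}=R\rtimes J$, $\mathcal{H}=S\rtimes K$. $\mathcal{A}$ is a left $\mathcal{H}$-module algebra under $\xi\triangleright\alpha=\tau(\alpha_1,\xi)\alpha_2$. The smash product $\mathcal{A}\#\mathcal{H}$ is the algebra on $\mathcal{A}\otimes\mathcal{H}$ (write $\alpha\#\xi=\alpha\otimes\xi$) with unit $1\#1$ and product $(\alpha\#\xi)(\beta\#\eta)=\tau(\beta_1,\xi_1)\,\alpha\beta_2\#\xi_2\eta$; it has the representation $\varpi:\mathcal{A}\#\mathcal{H}\to\mathrm{End}(\mathcal{A})$, $\varpi(\alpha\#\xi)(\beta)=\alpha(\xi\triangleright\beta)$. Since $R$, $S$ are left coideal subalgebras of $\mathcal{A}$, $\mathcal{H}$, the subspace $R\otimes S$ is a subalgebra of $\mathcal{A}\#\mathcal{H}$, denoted $R\#S$. *)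

theory Defs
  imports Complex_Main "HOL-Library.Function_Algebras"
begin

text \<open>
  A vector space over the field \<^typ>\<open>'k\<close> is a subspace \<open>carr X\<close> of a type that carries a vector space
  structure \<open>smul X\<close>. Every vector space arises in this way (as a full type), and so do the tensor
  products below, which can therefore be iterated.  All functions attached to a structure are
  only meaningful on the carriers.
\<close>

record ('k, 'a) vs =
  carr :: "'a set"
  smul :: "'k \<Rightarrow> 'a \<Rightarrow> 'a"

definition k_space :: "('k::field, 'a::ab_group_add, 'm) vs_scheme \<Rightarrow> bool" where
  "k_space X \<longleftrightarrow> vector_space (smul X) \<and> module.subspace (smul X) (carr X)"

definition ground :: "('k::field, 'k) vs" where
  "ground = \<lparr>carr = UNIV, smul = (*)\<rparr>"

definition lin ::
  "('k::field, 'a::ab_group_add, 'm) vs_scheme \<Rightarrow> ('k, 'b::ab_group_add, 'n) vs_scheme \<Rightarrow> ('a \<Rightarrow> 'b) \<Rightarrow> bool"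
  where "lin X Y f \<longleftrightarrow>
    (\<forall>x\<in>carr X. f x \<in> carr Y) \<and>
    (\<forall>x\<in>carr X. \<forall>x'\<in>carr X. f (x + x') = f x + f x') \<and>
    (\<forall>c. \<forall>x\<in>carr X. f (smul X c x) = smul Y c (f x))"

definition bilin ::
  "('k::field, 'a::ab_group_add, 'm) vs_scheme \<Rightarrow> ('k, 'b::ab_group_add, 'n) vs_scheme
    \<Rightarrow> ('k, 'c::ab_group_add, 'o) vs_scheme \<Rightarrow> ('a \<Rightarrow> 'b \<Rightarrow> 'c) \<Rightarrow> bool"
  where "bilin X Y Z B \<longleftrightarrow>
    (\<forall>x\<in>carr X. lin Y Z (B x)) \<and> (\<forall>y\<in>carr Y. lin X Z (\<lambda>x. B x y))"

section \<open>Tensor products\<close>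

text \<open>
  The tensor \<open>x \<otimes> y\<close> is realized as the evaluation functional \<open>B \<mapsto> B x y\<close> on bilinear forms
  on \<open>X \<times> Y\<close>, and \<open>X \<otimes> Y\<close> as the linear span of these functionals. Over a field this
  is a tensor product: the universal property is \<open>bilin_tens\<close>, \<open>sweedler_tens\<close>,
  \<open>lin_sweedler\<close> and \<open>tensor_lin_unique\<close> below.
\<close>

type_synonym ('k, 'a, 'b) tens = "('a \<Rightarrow> 'b \<Rightarrow> 'k) \<Rightarrow> 'k"

definition tens ::
  "('k::field, 'a::ab_group_add, 'm) vs_scheme \<Rightarrow> ('k, 'b::ab_group_add, 'n) vs_scheme
    \<Rightarrow> 'a \<Rightarrow> 'b \<Rightarrow> ('k, 'a, 'b) tens"
  where "tens X Y x y = (\<lambda>B. if bilin X Y ground B then B x y else 0)"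

definition tscale :: "'k::field \<Rightarrow> ('k, 'a, 'b) tens \<Rightarrow> ('k, 'a, 'b) tens" where
  "tscale c t = (\<lambda>B. c * t B)"

definition tspan ::
  "('k::field, 'a::ab_group_add, 'm) vs_scheme \<Rightarrow> ('k, 'b::ab_group_add, 'n) vs_scheme
    \<Rightarrow> 'a set \<Rightarrow> 'b set \<Rightarrow> ('k, 'a, 'b) tens set"
  where "tspan X Y A B = module.span tscale {tens X Y x y | x y. x \<in> A \<and> y \<in> B}"

definition tensor ::
  "('k::field, 'a::ab_group_add, 'm) vs_scheme \<Rightarrow> ('k, 'b::ab_group_add, 'n) vs_scheme
    \<Rightarrow> ('k, ('k, 'a, 'b) tens) vs"
  where "tensor X Y = \<lparr>carr = tspan X Y (carr X) (carr Y), smul = tscale\<rparr>"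

text \<open>
  Sweedler notation: \<open>sweedler X Y t (\<lambda>x y. B x y)\<close> is the sum of the \<open>B x\<^sub>i y\<^sub>i\<close> if \<open>t\<close> is
  the sum of the \<open>x\<^sub>i \<otimes> y\<^sub>i\<close>, that is, the image of \<open>t\<close> under the linear map
  on \<open>X \<otimes> Y\<close> induced by the bilinear map \<open>B\<close>.
\<close>

definition sweedler ::
  "('k::field, 'a::ab_group_add, 'm) vs_scheme \<Rightarrow> ('k, 'b::ab_group_add, 'n) vs_scheme
    \<Rightarrow> ('k, 'a, 'b) tens \<Rightarrow> ('a \<Rightarrow> 'b \<Rightarrow> 'c::ab_group_add) \<Rightarrow> 'c"
  where "sweedler X Y t B = (THE u. \<exists>ps. set ps \<subseteq> carr X \<times> carr Y \<and>
    t = (\<Sum>(x, y)\<leftarrow>ps. tens X Y x y) \<and> u = (\<Sum>(x, y)\<leftarrow>ps. B x y))"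

lemma linD:
  assumes "lin X Y f"
  shows "x \<in> carr X \<Longrightarrow> f x \<in> carr Y"
    and "x \<in> carr X \<Longrightarrow> x' \<in> carr X \<Longrightarrow> f (x + x') = f x + f x'"
    and "x \<in> carr X \<Longrightarrow> f (smul X c x) = smul Y c (f x)"
  using assms by (auto simp: lin_def)

lemma bilinD:
  assumes "bilin X Y Z B"
  shows "x \<in> carr X \<Longrightarrow> lin Y Z (B x)"
    and "y \<in> carr Y \<Longrightarrow> lin X Z (\<lambda>x. B x y)"
  using assms by (auto simp: bilin_def)

lemma k_spaceD:
  assumes "k_space X"
  shows "0 \<in> carr X" and "x \<in> carr X \<Longrightarrow> y \<in> carr X \<Longrightarrow> x + y \<in> carr X"
    and "x \<in> carr X \<Longrightarrow> smul X c x \<in> carr X"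
proof -
  interpret vector_space "smul X" using assms by (simp add: k_space_def)
  have "subspace (carr X)" using assms by (simp add: k_space_def)
  then show "0 \<in> carr X" and "x \<in> carr X \<Longrightarrow> y \<in> carr X \<Longrightarrow> x + y \<in> carr X"
    and "x \<in> carr X \<Longrightarrow> smul X c x \<in> carr X"
    by (auto simp: subspace_def)
qed

lemma vector_space_tscale: "vector_space (tscale :: 'k::field \<Rightarrow> ('k, 'a, 'b) tens \<Rightarrow> _)"
  by standard (auto simp: tscale_def fun_eq_iff algebra_simps)

lemma k_space_tensor:
  fixes X :: "('k::field, 'a::ab_group_add, 'm) vs_scheme" and Y :: "('k, 'b::ab_group_add, 'n) vs_scheme"
  shows "k_space (tensor X Y)"
proof -
  interpret vector_space "tscale :: 'k \<Rightarrow> ('k, 'a, 'b) tens \<Rightarrow> _" by (rule vector_space_tscale)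
  show ?thesis
    by (simp add: k_space_def tensor_def tspan_def vector_space_tscale subspace_span)
qed

lemma bilin_tens:
  fixes X :: "('k::field, 'a::ab_group_add, 'm) vs_scheme" and Y :: "('k, 'b::ab_group_add, 'n) vs_scheme"
  shows "bilin X Y (tensor X Y) (tens X Y)"
proof -
  interpret vector_space "tscale :: 'k \<Rightarrow> ('k, 'a, 'b) tens \<Rightarrow> _" by (rule vector_space_tscale)
  have "tens X Y x y \<in> carr (tensor X Y)" if "x \<in> carr X" "y \<in> carr Y" for x y
    using that by (auto simp: tensor_def tspan_def intro!: span_base)
  moreover have "tens X Y (x + x') y = tens X Y x y + tens X Y x' y"
    and "tens X Y (smul X c x) y = tscale c (tens X Y x y)"
    if "x \<in> carr X" "x' \<in> carr X" "y \<in> carr Y" for x x' y c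
    using that by (auto simp: tens_def tscale_def fun_eq_iff ground_def bilin_def lin_def)
  moreover have "tens X Y x (y + y') = tens X Y x y + tens X Y x y'"
    and "tens X Y x (smul Y c y) = tscale c (tens X Y x y)"
    if "x \<in> carr X" "y \<in> carr Y" "y' \<in> carr Y" for x y y' c
    using that by (auto simp: tens_def tscale_def fun_eq_iff ground_def bilin_def lin_def)
  ultimately show ?thesis
    by (simp add: bilin_def lin_def) (simp add: tensor_def)
qed

lemma tensor_sum:
  fixes X :: "('k::field, 'a::ab_group_add, 'm) vs_scheme" and Y :: "('k, 'b::ab_group_add, 'n) vs_scheme"
  assumes X: "k_space X" and t: "t \<in> carr (tensor X Y)"
  shows "\<exists>ps. set ps \<subseteq> carr X \<times> carr Y \<and> t = (\<Sum>(x, y)\<leftarrow>ps. tens X Y x y)"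
proof -
  interpret vector_space "tscale :: 'k \<Rightarrow> ('k, 'a, 'b) tens \<Rightarrow> _" by (rule vector_space_tscale)
  have "t \<in> span {tens X Y x y | x y. x \<in> carr X \<and> y \<in> carr Y}"
    using t by (simp add: tensor_def tspan_def)
  then show ?thesis
  proof (induction rule: span_induct_alt)
    case base
    show ?case by (rule exI[of _ "[]"]) simp
  next
    case (step c u t)
    then obtain x y ps where x: "x \<in> carr X" "y \<in> carr Y" "u = tens X Y x y"
      and ps: "set ps \<subseteq> carr X \<times> carr Y" "t = (\<Sum>(x, y)\<leftarrow>ps. tens X Y x y)" by blast
    have "tscale c u = tens X Y (smul X c x) y"
      using linD(3)[OF bilinD(2)[OF bilin_tens x(2)] x(1), of c] x(3) by (simp add: tensor_def)
    then show ?case using x ps k_spaceD(3)[OF X]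
      by (intro exI[of _ "(smul X c x, y) # ps"]) auto
  qed
qed

lemma lin_sum_list:
  assumes X: "k_space X" and Y: "k_space Y" and f: "lin X Y f" and xs: "set xs \<subseteq> carr X"
  shows "f (sum_list xs) = (\<Sum>x\<leftarrow>xs. f x) \<and> sum_list xs \<in> carr X"
  using xs
proof (induction xs)
  case Nil
  interpret vx: vector_space "smul X" using X by (simp add: k_space_def)
  interpret vy: vector_space "smul Y" using Y by (simp add: k_space_def)
  have "f 0 = 0" using linD(3)[OF f k_spaceD(1)[OF X], of 0] by simp
  then show ?case using k_spaceD(1)[OF X] by simp
next
  case (Cons x xs)
  then show ?case using linD(2)[OF f] k_spaceD(2)[OF X] by auto
qed

lemma bilin_sum_unique:
  fixes X :: "('k::field, 'a::ab_group_add, 'm) vs_scheme" and Y :: "('k, 'b::ab_group_add, 'n) vs_scheme"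
  assumes Z: "k_space Z" and B: "bilin X Y Z B"
    and ps: "set ps \<subseteq> carr X \<times> carr Y" and qs: "set qs \<subseteq> carr X \<times> carr Y"
    and eq: "(\<Sum>(x, y)\<leftarrow>ps. tens X Y x y) = (\<Sum>(x, y)\<leftarrow>qs. tens X Y x y)"
  shows "(\<Sum>(x, y)\<leftarrow>ps. B x y) = (\<Sum>(x, y)\<leftarrow>qs. B x y)"
proof (rule ccontr)
  interpret vz: vector_space "smul Z" using Z by (simp add: k_space_def)
  interpret vk: vector_space "(*) :: 'k \<Rightarrow> 'k \<Rightarrow> 'k" by standard (auto simp: algebra_simps)
  interpret p: vector_space_pair "smul Z" "(*) :: 'k \<Rightarrow> 'k \<Rightarrow> 'k" ..
  define d where "d = (\<Sum>(x, y)\<leftarrow>ps. B x y) - (\<Sum>(x, y)\<leftarrow>qs. B x y)"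
  assume "(\<Sum>(x, y)\<leftarrow>ps. B x y) \<noteq> (\<Sum>(x, y)\<leftarrow>qs. B x y)"
  then have "vz.independent {d}" by (simp add: d_def vz.dependent_single)
  from p.linear_independent_extend[OF this, of "\<lambda>_. 1"]
  obtain f where f: "Vector_Spaces.linear (smul Z) (*) f" and fd: "f d = 1" by auto
  interpret f: Vector_Spaces.linear "smul Z" "(*)" f by (rule f)
  have bf: "bilin X Y ground (\<lambda>x y. f (B x y))"
    using B unfolding bilin_def lin_def ground_def by (auto simp: f.add f.scale)
  have *: "(\<Sum>(x, y)\<leftarrow>rs. tens X Y x y) (\<lambda>x y. f (B x y)) = f (\<Sum>(x, y)\<leftarrow>rs. B x y)" for rs
    by (induction rs) (auto simp: f.add tens_def bf)
  have "f d = 0" using *[of ps] *[of qs] eq by (simp add: d_def f.diff)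
  with fd show False by simp
qed

lemma sweedler_sum:
  assumes Z: "k_space Z" and B: "bilin X Y Z B" and ps: "set ps \<subseteq> carr X \<times> carr Y"
  shows "sweedler X Y (\<Sum>(x, y)\<leftarrow>ps. tens X Y x y) B = (\<Sum>(x, y)\<leftarrow>ps. B x y)"
  unfolding sweedler_def
  by (rule the_equality) (use ps bilin_sum_unique[OF Z B] in metis)+

lemma sweedler_tens:
  assumes "k_space Z" and "bilin X Y Z B" and "x \<in> carr X" and "y \<in> carr Y"
  shows "sweedler X Y (tens X Y x y) B = B x y"
  using sweedler_sum[OF assms(1,2), of "[(x, y)]"] assms(3,4) by simp

lemma lin_sweedler:
  fixes X :: "('k::field, 'a::ab_group_add, 'm) vs_scheme" and Y :: "('k, 'b::ab_group_add, 'n) vs_scheme"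
  assumes X: "k_space X" and Z: "k_space Z" and B: "bilin X Y Z B"
  shows "lin (tensor X Y) Z (\<lambda>t. sweedler X Y t B)"
  unfolding lin_def
proof (intro conjI ballI allI)
  note sum = sweedler_sum[OF Z B]
  fix t assume t: "t \<in> carr (tensor X Y)"
  then obtain ps where ps: "set ps \<subseteq> carr X \<times> carr Y" "t = (\<Sum>(x, y)\<leftarrow>ps. tens X Y x y)"
    using tensor_sum[OF X] by blast
  interpret vz: vector_space "smul Z" using Z by (simp add: k_space_def)
  have "(\<Sum>(x, y)\<leftarrow>ps. B x y) \<in> carr Z" using ps(1)
    by (induction ps) (use k_spaceD[OF Z] linD(1)[OF bilinD(1)[OF B]] in auto)
  then show "sweedler X Y t B \<in> carr Z" using sum[OF ps(1)] ps(2) by simp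
  show "sweedler X Y (t + t') B = sweedler X Y t B + sweedler X Y t' B"
    if t': "t' \<in> carr (tensor X Y)" for t'
  proof -
    obtain qs where qs: "set qs \<subseteq> carr X \<times> carr Y" "t' = (\<Sum>(x, y)\<leftarrow>qs. tens X Y x y)"
      using tensor_sum[OF X t'] by blast
    show ?thesis using sum[of "ps @ qs"] sum[of ps] sum[of qs] ps qs by simp
  qed
  show "sweedler X Y (smul (tensor X Y) c t) B = smul Z c (sweedler X Y t B)" for c
  proof -
    define qs where "qs = map (\<lambda>(x, y). (smul X c x, y)) ps"
    have qs: "set qs \<subseteq> carr X \<times> carr Y" using ps(1) k_spaceD(3)[OF X] by (auto simp: qs_def)
    interpret vt: vector_space "tscale :: 'k \<Rightarrow> ('k, 'a, 'b) tens \<Rightarrow> _" by (rule vector_space_tscale)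
    have "tens X Y (smul X c x) y = tscale c (tens X Y x y)" if "x \<in> carr X" "y \<in> carr Y" for x y
      using linD(3)[OF bilinD(2)[OF bilin_tens that(2)] that(1), of c] by (simp add: tensor_def)
    then have 1: "smul (tensor X Y) c t = (\<Sum>(x, y)\<leftarrow>qs. tens X Y x y)"
      using ps unfolding qs_def ps(2)
      by (simp add: tensor_def, induction ps) (auto simp: vt.scale_right_distrib)
    have 2: "smul Z c (\<Sum>(x, y)\<leftarrow>ps. B x y) = (\<Sum>(x, y)\<leftarrow>qs. B x y)" using ps(1) unfolding qs_def
      by (induction ps) (auto simp: vz.scale_right_distrib linD(3)[OF bilinD(2)[OF B]])
    show ?thesis unfolding 1 unfolding ps(2) sum[OF ps(1)] sum[OF qs] 2 ..
  qed
qed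

lemma tensor_lin_unique:
  assumes X: "k_space X" and Z: "k_space Z"
    and f: "lin (tensor X Y) Z f" and g: "lin (tensor X Y) Z g"
    and eq: "\<And>x y. x \<in> carr X \<Longrightarrow> y \<in> carr Y \<Longrightarrow> f (tens X Y x y) = g (tens X Y x y)"
    and t: "t \<in> carr (tensor X Y)"
  shows "f t = g t"
proof -
  obtain ps where ps: "set ps \<subseteq> carr X \<times> carr Y" "t = (\<Sum>(x, y)\<leftarrow>ps. tens X Y x y)"
    using tensor_sum[OF X t] by blast
  let ?xs = "map (\<lambda>(x, y). tens X Y x y) ps"
  have xs: "set ?xs \<subseteq> carr (tensor X Y)"
    using ps(1) linD(1)[OF bilinD(1)[OF bilin_tens[of X Y]]] by auto
  have "map f ?xs = map g ?xs" using ps(1) eq by auto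
  then show ?thesis
    using lin_sum_list[OF k_space_tensor Z f xs] lin_sum_list[OF k_space_tensor Z g xs] ps(2)
    by metis
qed

section \<open>Algebras, bialgebras and Hopf algebras\<close>

record ('k, 'a) alg = "('k, 'a) vs" +
  mul :: "'a \<Rightarrow> 'a \<Rightarrow> 'a"
  unity :: "'a"

record ('k, 'a) bialg = "('k, 'a) alg" +
  comul :: "'a \<Rightarrow> ('k, 'a, 'a) tens"
  counit :: "'a \<Rightarrow> 'k"

record ('k, 'a) hopf = "('k, 'a) bialg" +
  antipode :: "'a \<Rightarrow> 'a"

definition algebra :: "('k::field, 'a::ab_group_add, 'm) alg_scheme \<Rightarrow> bool" where
  "algebra A \<longleftrightarrow> k_space A \<and> bilin A A A (mul A) \<and> unity A \<in> carr A \<and>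
    (\<forall>x\<in>carr A. \<forall>y\<in>carr A. \<forall>z\<in>carr A. mul A (mul A x y) z = mul A x (mul A y z)) \<and>
    (\<forall>x\<in>carr A. mul A (unity A) x = x \<and> mul A x (unity A) = x)"

definition alg_hom ::
  "('k::field, 'a::ab_group_add, 'm) alg_scheme \<Rightarrow> ('k, 'b::ab_group_add, 'n) alg_scheme
    \<Rightarrow> ('a \<Rightarrow> 'b) \<Rightarrow> bool"
  where "alg_hom A B f \<longleftrightarrow> algebra A \<and> algebra B \<and> lin A B f \<and>
    f (unity A) = unity B \<and>
    (\<forall>x\<in>carr A. \<forall>y\<in>carr A. f (mul A x y) = mul B (f x) (f y))"

definition alg_iso ::
  "('k::field, 'a::ab_group_add, 'm) alg_scheme \<Rightarrow> ('k, 'b::ab_group_add, 'n) alg_scheme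
    \<Rightarrow> ('a \<Rightarrow> 'b) \<Rightarrow> bool"
  where "alg_iso A B f \<longleftrightarrow> alg_hom A B f \<and> bij_betw f (carr A) (carr B)"

text \<open>A linear representation \<open>A \<rightarrow> End(X)\<close>, given by \<open>\<rho> a x\<close>.\<close>

definition alg_rep ::
  "('k::field, 'a::ab_group_add, 'm) alg_scheme \<Rightarrow> ('k, 'b::ab_group_add, 'n) vs_scheme
    \<Rightarrow> ('a \<Rightarrow> 'b \<Rightarrow> 'b) \<Rightarrow> bool"
  where "alg_rep A X \<rho> \<longleftrightarrow> algebra A \<and> k_space X \<and> bilin A X X \<rho> \<and>
    (\<forall>x\<in>carr X. \<rho> (unity A) x = x) \<and>
    (\<forall>a\<in>carr A. \<forall>b\<in>carr A. \<forall>x\<in>carr X. \<rho> (mul A a b) x = \<rho> a (\<rho> b x))"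

text \<open>Coassociativity is stated in \<open>C \<otimes> (C \<otimes> C)\<close>.\<close>

definition coalgebra :: "('k::field, 'a::ab_group_add, 'm) bialg_scheme \<Rightarrow> bool" where
  "coalgebra C \<longleftrightarrow> k_space C \<and> lin C (tensor C C) (comul C) \<and> lin C ground (counit C) \<and>
    (\<forall>c\<in>carr C.
      sweedler C C (comul C c) (\<lambda>c1 c2. smul C (counit C c1) c2) = c \<and>
      sweedler C C (comul C c) (\<lambda>c1 c2. smul C (counit C c2) c1) = c \<and>
      sweedler C C (comul C c) (\<lambda>c1 c2. tens C (tensor C C) c1 (comul C c2)) =
      sweedler C C (comul C c) (\<lambda>c1 c2. sweedler C C (comul C c1) (\<lambda>c11 c12.
        tens C (tensor C C) c11 (tens C C c12 c2))))"

definition bialgebra :: "('k::field, 'a::ab_group_add, 'm) bialg_scheme \<Rightarrow> bool" where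
  "bialgebra C \<longleftrightarrow> algebra C \<and> coalgebra C \<and>
    comul C (unity C) = tens C C (unity C) (unity C) \<and>
    counit C (unity C) = 1 \<and>
    (\<forall>x\<in>carr C. \<forall>y\<in>carr C.
      counit C (mul C x y) = counit C x * counit C y \<and>
      comul C (mul C x y) =
        sweedler C C (comul C x) (\<lambda>x1 x2. sweedler C C (comul C y) (\<lambda>y1 y2.
          tens C C (mul C x1 y1) (mul C x2 y2))))"

definition hopf_algebra :: "('k::field, 'a::ab_group_add, 'm) hopf_scheme \<Rightarrow> bool" where
  "hopf_algebra J \<longleftrightarrow> bialgebra J \<and> lin J J (antipode J) \<and>
    (\<forall>a\<in>carr J.
      sweedler J J (comul J a) (\<lambda>a1 a2. mul J (antipode J a1) a2) = smul J (counit J a) (unity J) \<and>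
      sweedler J J (comul J a) (\<lambda>a1 a2. mul J a1 (antipode J a2)) = smul J (counit J a) (unity J))"

definition hopf_algebra_bij :: "('k::field, 'a::ab_group_add, 'm) hopf_scheme \<Rightarrow> bool" where
  "hopf_algebra_bij J \<longleftrightarrow> hopf_algebra J \<and> bij_betw (antipode J) (carr J) (carr J)"

definition skew_pairing ::
  "('k::field, 'a::ab_group_add, 'm) bialg_scheme \<Rightarrow> ('k, 'b::ab_group_add, 'n) bialg_scheme
    \<Rightarrow> ('a \<Rightarrow> 'b \<Rightarrow> 'k) \<Rightarrow> bool"
  where "skew_pairing A X \<tau> \<longleftrightarrow> bilin A X ground \<tau> \<and>
    (\<forall>a\<in>carr A. \<forall>b\<in>carr A. \<forall>x\<in>carr X.
      \<tau> (mul A a b) x = sweedler X X (comul X x) (\<lambda>x1 x2. \<tau> a x1 * \<tau> b x2)) \<and>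
    (\<forall>a\<in>carr A. \<forall>x\<in>carr X. \<forall>y\<in>carr X.
      \<tau> a (mul X x y) = sweedler A A (comul A a) (\<lambda>a1 a2. \<tau> a1 y * \<tau> a2 x)) \<and>
    (\<forall>x\<in>carr X. \<tau> (unity A) x = counit X x) \<and>
    (\<forall>a\<in>carr A. \<tau> a (unity X) = counit A a)"

section \<open>Yetter-Drinfeld modules and pre-Nichols algebras\<close>

definition yd_module ::
  "('k::field, 'j::ab_group_add, 'm) hopf_scheme \<Rightarrow> ('k, 'v::ab_group_add, 'n) vs_scheme
    \<Rightarrow> ('j \<Rightarrow> 'v \<Rightarrow> 'v) \<Rightarrow> ('v \<Rightarrow> ('k, 'j, 'v) tens) \<Rightarrow> bool"
  where "yd_module J X act coact \<longleftrightarrow>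
    alg_rep J X act \<and> lin X (tensor J X) coact \<and>
    (\<forall>x\<in>carr X.
      sweedler J X (coact x) (\<lambda>h y. smul X (counit J h) y) = x \<and>
      sweedler J X (coact x) (\<lambda>h y. tens J (tensor J X) h (coact y)) =
      sweedler J X (coact x) (\<lambda>h y. sweedler J J (comul J h) (\<lambda>h1 h2.
        tens J (tensor J X) h1 (tens J X h2 y)))) \<and>
    (\<forall>a\<in>carr J. \<forall>x\<in>carr X.
      coact (act a x) =
        sweedler J J (comul J a) (\<lambda>a1 a'. sweedler J J (comul J a') (\<lambda>a2 a3.
          sweedler J X (coact x) (\<lambda>h y.
            tens J X (mul J (mul J a1 h) (antipode J a3)) (act a2 y)))))"

record ('k, 'v, 'j) yd = "('k, 'v) vs" +
  act :: "'j \<Rightarrow> 'v \<Rightarrow> 'v"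
  coact :: "'v \<Rightarrow> ('k, 'j, 'v) tens"

text \<open>Algebra, coalgebra, Yetter-Drinfeld and graded structure on one space; \<open>grade R n\<close> is \<open>R(n)\<close>.\<close>

record ('k, 'r, 'j) yd_bialg = "('k, 'r) bialg" +
  ract :: "'j \<Rightarrow> 'r \<Rightarrow> 'r"
  rcoact :: "'r \<Rightarrow> ('k, 'j, 'r) tens"
  grade :: "nat \<Rightarrow> 'r set"

text \<open>
  The structure maps of a bialgebra in the Yetter-Drinfeld category are morphisms in that category,
  and the coproduct is multiplicative for the product on \<open>R \<otimes> R\<close> twisted by the braiding:
  \<open>\<Delta>(rs) = r\<^sub>1 (r\<^sub>2\<^sub>J \<rightharpoonup> s\<^sub>1) \<otimes> r\<^sub>2\<^sub>R s\<^sub>2\<close>.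
\<close>

definition braided_bialgebra ::
  "('k::field, 'j::ab_group_add, 'm) hopf_scheme \<Rightarrow> ('k, 'r::ab_group_add, 'j, 'n) yd_bialg_scheme \<Rightarrow> bool"
  where "braided_bialgebra J R \<longleftrightarrow>
    yd_module J R (ract R) (rcoact R) \<and> algebra R \<and> coalgebra R \<and>
    \<comment> \<open>unit and product are morphisms\<close>
    (\<forall>a\<in>carr J. ract R a (unity R) = smul R (counit J a) (unity R)) \<and>
    rcoact R (unity R) = tens J R (unity J) (unity R) \<and>
    (\<forall>a\<in>carr J. \<forall>r\<in>carr R. \<forall>s\<in>carr R.
      ract R a (mul R r s) =
        sweedler J J (comul J a) (\<lambda>a1 a2. mul R (ract R a1 r) (ract R a2 s))) \<and>
    (\<forall>r\<in>carr R. \<forall>s\<in>carr R.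
      rcoact R (mul R r s) =
        sweedler J R (rcoact R r) (\<lambda>h r'. sweedler J R (rcoact R s) (\<lambda>h' s'.
          tens J R (mul J h h') (mul R r' s')))) \<and>
    \<comment> \<open>counit and coproduct are morphisms\<close>
    (\<forall>a\<in>carr J. \<forall>r\<in>carr R. counit R (ract R a r) = counit J a * counit R r) \<and>
    (\<forall>r\<in>carr R.
      sweedler J R (rcoact R r) (\<lambda>h r'. smul J (counit R r') h) = smul J (counit R r) (unity J)) \<and>
    (\<forall>a\<in>carr J. \<forall>r\<in>carr R.
      comul R (ract R a r) =
        sweedler J J (comul J a) (\<lambda>a1 a2. sweedler R R (comul R r) (\<lambda>r1 r2.
          tens R R (ract R a1 r1) (ract R a2 r2)))) \<and>
    (\<forall>r\<in>carr R.
      sweedler J R (rcoact R r) (\<lambda>h r'. tens J (tensor R R) h (comul R r')) =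
      sweedler R R (comul R r) (\<lambda>r1 r2.
        sweedler J R (rcoact R r1) (\<lambda>h1 r1'. sweedler J R (rcoact R r2) (\<lambda>h2 r2'.
          tens J (tensor R R) (mul J h1 h2) (tens R R r1' r2'))))) \<and>
    \<comment> \<open>counit and coproduct are (braided) multiplicative\<close>
    counit R (unity R) = 1 \<and>
    comul R (unity R) = tens R R (unity R) (unity R) \<and>
    (\<forall>r\<in>carr R. \<forall>s\<in>carr R. counit R (mul R r s) = counit R r * counit R s) \<and>
    (\<forall>r\<in>carr R. \<forall>s\<in>carr R.
      comul R (mul R r s) =
        sweedler R R (comul R r) (\<lambda>r1 r2. sweedler R R (comul R s) (\<lambda>s1 s2.
          sweedler J R (rcoact R r2) (\<lambda>h r2'.
            tens R R (mul R r1 (ract R h s1)) (mul R r2' s2)))))"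

definition direct_sum ::
  "('k::field, 'a::ab_group_add, 'm) vs_scheme \<Rightarrow> (nat \<Rightarrow> 'a set) \<Rightarrow> bool"
  where "direct_sum X G \<longleftrightarrow>
    (\<forall>n. module.subspace (smul X) (G n) \<and> G n \<subseteq> carr X) \<and>
    (\<forall>x\<in>carr X. \<exists>!f. (\<forall>n. f n \<in> G n) \<and> finite {n. f n \<noteq> 0} \<and> x = (\<Sum>n | f n \<noteq> 0. f n))"

definition graded_braided_bialgebra ::
  "('k::field, 'j::ab_group_add, 'm) hopf_scheme \<Rightarrow> ('k, 'r::ab_group_add, 'j, 'n) yd_bialg_scheme \<Rightarrow> bool"
  where "graded_braided_bialgebra J R \<longleftrightarrow>
    braided_bialgebra J R \<and> direct_sum R (grade R) \<and> unity R \<in> grade R 0 \<and>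
    (\<forall>n. \<forall>r\<in>grade R n. \<forall>m. \<forall>s\<in>grade R m. mul R r s \<in> grade R (n + m)) \<and>
    (\<forall>n>0. \<forall>r\<in>grade R n. counit R r = 0) \<and>
    (\<forall>n. \<forall>r\<in>grade R n. comul R r \<in>
      module.span tscale (\<Union>i\<le>n. tspan R R (grade R i) (grade R (n - i)))) \<and>
    (\<forall>n. \<forall>r\<in>grade R n.
      (\<forall>a\<in>carr J. ract R a r \<in> grade R n) \<and> rcoact R r \<in> tspan J R (carr J) (grade R n))"

definition generated_by :: "('k::field, 'a::ab_group_add, 'm) alg_scheme \<Rightarrow> 'a set \<Rightarrow> bool" where
  "generated_by A G \<longleftrightarrow> (\<forall>U. module.subspace (smul A) U \<and> G \<subseteq> U \<and> unity A \<in> U \<and>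
    (\<forall>x\<in>U. \<forall>y\<in>U. mul A x y \<in> U) \<longrightarrow> carr A \<subseteq> U)"

text \<open>
  \<open>R\<close> is a pre-Nichols algebra of \<open>V\<close>, in its intrinsic form: a braided graded bialgebra with
  \<open>R(0) = k\<close>, generated by \<open>R(1) = V\<close>. The identification \<open>V = R(1)\<close>, that is, the restriction to \<open>V\<close> of
  the projection \<open>T(V) \<rightarrow> R\<close>, is the Yetter-Drinfeld isomorphism \<open>\<iota>\<close>.
\<close>

definition pre_nichols ::
  "('k::field, 'j::ab_group_add, 'm) hopf_scheme \<Rightarrow> ('k, 'v::ab_group_add, 'j, 'n) yd_scheme
    \<Rightarrow> ('k, 'r::ab_group_add, 'j, 'o) yd_bialg_scheme \<Rightarrow> ('v \<Rightarrow> 'r) \<Rightarrow> bool"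
  where "pre_nichols J V R \<iota> \<longleftrightarrow>
    graded_braided_bialgebra J R \<and>
    grade R 0 = {smul R c (unity R) | c. True} \<and>
    lin V R \<iota> \<and> bij_betw \<iota> (carr V) (grade R 1) \<and>
    (\<forall>a\<in>carr J. \<forall>v\<in>carr V. \<iota> (act V a v) = ract R a (\<iota> v)) \<and>
    (\<forall>v\<in>carr V. rcoact R (\<iota> v) = sweedler J V (coact V v) (\<lambda>h v'. tens J R h (\<iota> v'))) \<and>
    generated_by R (grade R 1)"

section \<open>Bosonization\<close>

definition bosonization ::
  "('k::field, 'r::ab_group_add, 'j::ab_group_add, 'n) yd_bialg_scheme \<Rightarrow> ('k, 'j, 'm) hopf_scheme
    \<Rightarrow> ('k, ('k, 'r, 'j) tens) bialg"
  where "bosonization R J =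
    \<lparr>carr = carr (tensor R J),
     smul = smul (tensor R J),
     mul = (\<lambda>\<alpha> \<beta>. sweedler R J \<alpha> (\<lambda>r a. sweedler R J \<beta> (\<lambda>s b.
       sweedler J J (comul J a) (\<lambda>a1 a2. tens R J (mul R r (ract R a1 s)) (mul J a2 b))))),
     unity = tens R J (unity R) (unity J),
     comul = (\<lambda>\<alpha>. sweedler R J \<alpha> (\<lambda>r a.
       sweedler R R (comul R r) (\<lambda>r1 r2. sweedler J R (rcoact R r2) (\<lambda>h r2'.
         sweedler J J (comul J a) (\<lambda>a1 a2.
           tens (tensor R J) (tensor R J) (tens R J r1 (mul J h a1)) (tens R J r2' a2)))))),
     counit = (\<lambda>\<alpha>. sweedler R J \<alpha> (\<lambda>r a. counit R r * counit J a))\<rparr>"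

definition bos_R ::
  "('k::field, 'r::ab_group_add, 'j::ab_group_add, 'n) yd_bialg_scheme \<Rightarrow> ('k, 'j, 'm) hopf_scheme
    \<Rightarrow> 'r \<Rightarrow> ('k, 'r, 'j) tens"
  where "bos_R R J r = tens R J r (unity J)"

definition bos_J ::
  "('k::field, 'r::ab_group_add, 'j::ab_group_add, 'n) yd_bialg_scheme \<Rightarrow> ('k, 'j, 'm) hopf_scheme
    \<Rightarrow> 'j \<Rightarrow> ('k, 'r, 'j) tens"
  where "bos_J R J a = tens R J (unity R) a"

section \<open>The data, the extended pairing and the algebras built from them\<close>

definition pairing_data ::
  "('k::field, 'j::ab_group_add, 'm1) hopf_scheme \<Rightarrow> ('k, 'c::ab_group_add, 'm2) hopf_scheme
    \<Rightarrow> ('j \<Rightarrow> 'c \<Rightarrow> 'k)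
    \<Rightarrow> ('k, 'v::ab_group_add, 'j, 'm3) yd_scheme \<Rightarrow> ('k, 'w::ab_group_add, 'c, 'm4) yd_scheme
    \<Rightarrow> ('v \<Rightarrow> 'w \<Rightarrow> 'k) \<Rightarrow> bool"
  where "pairing_data J K \<tau>0 V W \<tau>1 \<longleftrightarrow>
    hopf_algebra_bij J \<and> hopf_algebra_bij K \<and> skew_pairing J K \<tau>0 \<and>
    yd_module J V (act V) (coact V) \<and> yd_module K W (act W) (coact W) \<and>
    bilin V W ground \<tau>1 \<and>
    (\<forall>a\<in>carr J. \<forall>v\<in>carr V. \<forall>w\<in>carr W.
      \<tau>1 (act V a v) w = sweedler K W (coact W w) (\<lambda>h w'. \<tau>0 a h * \<tau>1 v w')) \<and>
    (\<forall>x\<in>carr K. \<forall>v\<in>carr V. \<forall>w\<in>carr W.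
      \<tau>1 v (act W x w) = sweedler J V (coact V v) (\<lambda>h v'. \<tau>0 h (antipode K x) * \<tau>1 v' w))"

definition extended_pairing ::
  "('k::field, 'j::ab_group_add, 'm1) hopf_scheme \<Rightarrow> ('k, 'c::ab_group_add, 'm2) hopf_scheme
    \<Rightarrow> ('j \<Rightarrow> 'c \<Rightarrow> 'k)
    \<Rightarrow> ('k, 'v::ab_group_add, 'j, 'm3) yd_scheme \<Rightarrow> ('k, 'w::ab_group_add, 'c, 'm4) yd_scheme
    \<Rightarrow> ('v \<Rightarrow> 'w \<Rightarrow> 'k)
    \<Rightarrow> ('k, 'r::ab_group_add, 'j, 'm5) yd_bialg_scheme \<Rightarrow> ('v \<Rightarrow> 'r)
    \<Rightarrow> ('k, 's::ab_group_add, 'c, 'm6) yd_bialg_scheme \<Rightarrow> ('w \<Rightarrow> 's)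
    \<Rightarrow> (('k, 'r, 'j) tens \<Rightarrow> ('k, 's, 'c) tens \<Rightarrow> 'k) \<Rightarrow> bool"
  where "extended_pairing J K \<tau>0 V W \<tau>1 R \<iota> S \<kappa> \<tau> \<longleftrightarrow>
    skew_pairing (bosonization R J) (bosonization S K) \<tau> \<and>
    (\<forall>a\<in>carr J. \<forall>x\<in>carr K. \<tau> (bos_J R J a) (bos_J S K x) = \<tau>0 a x) \<and>
    (\<forall>v\<in>carr V. \<forall>w\<in>carr W. \<tau> (bos_R R J (\<iota> v)) (bos_R S K (\<kappa> w)) = \<tau>1 v w) \<and>
    (\<forall>a\<in>carr J. \<forall>w\<in>carr W. \<tau> (bos_J R J a) (bos_R S K (\<kappa> w)) = 0) \<and>
    (\<forall>v\<in>carr V. \<forall>x\<in>carr K. \<tau> (bos_R R J (\<iota> v)) (bos_J S K x) = 0)"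

text \<open>Products vanish off the carrier, which makes the unique algebra structure unique as a function.\<close>

definition q_boson_product ::
  "('k::field, 'j::ab_group_add, 'm1) hopf_scheme \<Rightarrow> ('k, 'c::ab_group_add, 'm2) hopf_scheme
    \<Rightarrow> ('j \<Rightarrow> 'c \<Rightarrow> 'k)
    \<Rightarrow> ('k, 'v::ab_group_add, 'j, 'm3) yd_scheme \<Rightarrow> ('k, 'w::ab_group_add, 'c, 'm4) yd_scheme
    \<Rightarrow> ('v \<Rightarrow> 'w \<Rightarrow> 'k)
    \<Rightarrow> ('k, 'r::ab_group_add, 'j, 'm5) yd_bialg_scheme \<Rightarrow> ('v \<Rightarrow> 'r)
    \<Rightarrow> ('k, 's::ab_group_add, 'c, 'm6) yd_bialg_scheme \<Rightarrow> ('w \<Rightarrow> 's)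
    \<Rightarrow> (('k, 'r, 's) tens \<Rightarrow> ('k, 'r, 's) tens \<Rightarrow> ('k, 'r, 's) tens) \<Rightarrow> bool"
  where "q_boson_product J K \<tau>0 V W \<tau>1 R \<iota> S \<kappa> m \<longleftrightarrow>
    algebra \<lparr>carr = carr (tensor R S), smul = smul (tensor R S),
             mul = m, unity = tens R S (unity R) (unity S)\<rparr> \<and>
    (\<forall>x y. x \<notin> carr (tensor R S) \<or> y \<notin> carr (tensor R S) \<longrightarrow> m x y = 0) \<and>
    (\<forall>r\<in>carr R. \<forall>r'\<in>carr R.
      m (tens R S r (unity S)) (tens R S r' (unity S)) = tens R S (mul R r r') (unity S)) \<and>
    (\<forall>s\<in>carr S. \<forall>s'\<in>carr S.
      m (tens R S (unity R) s) (tens R S (unity R) s') = tens R S (unity R) (mul S s s')) \<and>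
    (\<forall>r\<in>carr R. \<forall>s\<in>carr S.
      m (tens R S r (unity S)) (tens R S (unity R) s) = tens R S r s) \<and>
    (\<forall>v\<in>carr V. \<forall>w\<in>carr W.
      m (tens R S (unity R) (\<kappa> w)) (tens R S (\<iota> v) (unity S)) =
        sweedler J V (coact V v) (\<lambda>g v'. sweedler K W (coact W w) (\<lambda>h w'.
          tscale (\<tau>0 g h) (tens R S (\<iota> v') (\<kappa> w'))))
        + tscale (\<tau>1 v w) (tens R S (unity R) (unity S)))"

definition q_boson ::
  "('k::field, 'j::ab_group_add, 'm1) hopf_scheme \<Rightarrow> ('k, 'c::ab_group_add, 'm2) hopf_scheme
    \<Rightarrow> ('j \<Rightarrow> 'c \<Rightarrow> 'k)
    \<Rightarrow> ('k, 'v::ab_group_add, 'j, 'm3) yd_scheme \<Rightarrow> ('k, 'w::ab_group_add, 'c, 'm4) yd_scheme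
    \<Rightarrow> ('v \<Rightarrow> 'w \<Rightarrow> 'k)
    \<Rightarrow> ('k, 'r::ab_group_add, 'j, 'm5) yd_bialg_scheme \<Rightarrow> ('v \<Rightarrow> 'r)
    \<Rightarrow> ('k, 's::ab_group_add, 'c, 'm6) yd_bialg_scheme \<Rightarrow> ('w \<Rightarrow> 's)
    \<Rightarrow> ('k, ('k, 'r, 's) tens) alg"
  where "q_boson J K \<tau>0 V W \<tau>1 R \<iota> S \<kappa> =
    \<lparr>carr = carr (tensor R S), smul = smul (tensor R S),
     mul = (THE m. q_boson_product J K \<tau>0 V W \<tau>1 R \<iota> S \<kappa> m),
     unity = tens R S (unity R) (unity S)\<rparr>"

text \<open>\<open>hact A H \<tau> \<xi> \<alpha>\<close> is \<open>\<xi> \<triangleright> \<alpha> = \<tau>(\<alpha>\<^sub>1, \<xi>) \<alpha>\<^sub>2\<close>.\<close>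

definition hact ::
  "('k::field, 'a::ab_group_add, 'm) bialg_scheme \<Rightarrow> ('a \<Rightarrow> 'h \<Rightarrow> 'k) \<Rightarrow> 'h \<Rightarrow> 'a \<Rightarrow> 'a"
  where "hact A \<tau> \<xi> \<alpha> = sweedler A A (comul A \<alpha>) (\<lambda>\<alpha>1 \<alpha>2. smul A (\<tau> \<alpha>1 \<xi>) \<alpha>2)"

definition smash ::
  "('k::field, 'a::ab_group_add, 'm) bialg_scheme \<Rightarrow> ('k, 'h::ab_group_add, 'n) bialg_scheme
    \<Rightarrow> ('a \<Rightarrow> 'h \<Rightarrow> 'k) \<Rightarrow> ('k, ('k, 'a, 'h) tens) alg"
  where "smash A H \<tau> =
    \<lparr>carr = carr (tensor A H), smul = smul (tensor A H),
     mul = (\<lambda>z z'. sweedler A H z (\<lambda>\<alpha> \<xi>. sweedler A H z' (\<lambda>\<beta> \<eta>.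
       sweedler A A (comul A \<beta>) (\<lambda>\<beta>1 \<beta>2. sweedler H H (comul H \<xi>) (\<lambda>\<xi>1 \<xi>2.
         tscale (\<tau> \<beta>1 \<xi>1) (tens A H (mul A \<alpha> \<beta>2) (mul H \<xi>2 \<eta>))))))),
     unity = tens A H (unity A) (unity H)\<rparr>"

text \<open>The representation \<open>\<varpi>\<close> of the smash product on \<open>A\<close>.\<close>

definition smash_rep ::
  "('k::field, 'a::ab_group_add, 'm) bialg_scheme \<Rightarrow> ('k, 'h::ab_group_add, 'n) bialg_scheme
    \<Rightarrow> ('a \<Rightarrow> 'h \<Rightarrow> 'k) \<Rightarrow> ('k, 'a, 'h) tens \<Rightarrow> 'a \<Rightarrow> 'a"
  where "smash_rep A H \<tau> z \<beta> = sweedler A H z (\<lambda>\<alpha> \<xi>. mul A \<alpha> (hact A \<tau> \<xi> \<beta>))"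

text \<open>The element \<open>r # s\<close> of the smash product, and the subspace \<open>R # S\<close> spanned by these elements.\<close>

definition RS_elem ::
  "('k::field, 'r::ab_group_add, 'j::ab_group_add, 'm1) yd_bialg_scheme \<Rightarrow> ('k, 'j, 'm2) hopf_scheme
    \<Rightarrow> ('k, 's::ab_group_add, 'c::ab_group_add, 'm3) yd_bialg_scheme \<Rightarrow> ('k, 'c, 'm4) hopf_scheme
    \<Rightarrow> 'r \<Rightarrow> 's \<Rightarrow> ('k, ('k, 'r, 'j) tens, ('k, 's, 'c) tens) tens"
  where "RS_elem R J S K r s =
    tens (bosonization R J) (bosonization S K) (bos_R R J r) (bos_R S K s)"

definition RS_algebra ::
  "('k::field, 'r::ab_group_add, 'j::ab_group_add, 'm1) yd_bialg_scheme \<Rightarrow> ('k, 'j, 'm2) hopf_scheme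
    \<Rightarrow> ('k, 's::ab_group_add, 'c::ab_group_add, 'm3) yd_bialg_scheme \<Rightarrow> ('k, 'c, 'm4) hopf_scheme
    \<Rightarrow> (('k, 'r, 'j) tens \<Rightarrow> ('k, 's, 'c) tens \<Rightarrow> 'k)
    \<Rightarrow> ('k, ('k, ('k, 'r, 'j) tens, ('k, 's, 'c) tens) tens) alg"
  where "RS_algebra R J S K \<tau> =
    (smash (bosonization R J) (bosonization S K) \<tau>)
      \<lparr>carr := tspan (bosonization R J) (bosonization S K)
         (bos_R R J ` carr R) (bos_R S K ` carr S)\<rparr>"

end

theory Submission
  imports Defs
begin

text \<open>
  Restricted to \<open>R\<close>, the coproduct of the bosonization is a left coaction
  \<open>\<delta>(r) = r\<^sub>1 r\<^sub>2\<^sub>J \<otimes> r\<^sub>2\<^sub>R\<close>, which makes \<open>R\<close> a left coideal subalgebra of \<open>\<A>\<close>;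
  likewise for \<open>S \<subseteq> \<H>\<close>. By the skew pairing, \<open>\<H>\<close> acts on \<open>R\<close> by \<open>x \<triangleright> r = \<tau>(r\<^sub>\<A>, x) r\<^sub>R\<close>, a module algebra
  action, so \<open>(r \<otimes> s)(r' \<otimes> s') = r (s\<^sub>\<H> \<triangleright> r') \<otimes> s\<^sub>S s'\<close> is an associative product on \<open>R \<otimes> S\<close>, and
  the injection \<open>R \<otimes> S \<rightarrow> \<A> \<otimes> \<H>\<close> carries it to the smash product. As \<open>V\<close> and \<open>W\<close> are primitive in \<open>R\<close>
  and \<open>S\<close>, this product satisfies the defining relation between \<open>w\<close> and \<open>v\<close> of the q-boson algebra.
  That relation determines the products \<open>w r\<close>, since \<open>w r\<close> stays in \<open>R \<otimes> (k + W)\<close>, and then the products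
  \<open>s r\<close>, because \<open>V\<close> generates \<open>R\<close> and \<open>W\<close> generates \<open>S\<close>. The representation on \<open>R\<close> is
  \<open>r # s \<mapsto> r (s \<triangleright> -)\<close>.
\<close>

section \<open>Linear maps in Sweedler notation\<close>

text \<open>The side conditions of all computations with Sweedler sums are linearity and membership
  statements about nested expressions; resolution with \<open>lin_rules\<close> decides them. Rewriting with
  \<open>pull_out\<close> moves Sweedler sums and scalars out of multilinear operations.\<close>

named_theorems lin_rules
named_theorems pull_out

lemma bilinI:
  assumes "\<And>x. x \<in> carr X \<Longrightarrow> lin Y Z (\<lambda>y. B x y)"
    and "\<And>y. y \<in> carr Y \<Longrightarrow> lin X Z (\<lambda>x. B x y)"
  shows "bilin X Y Z B"
  using assms by (simp add: bilin_def)

lemma k_space_ground: "k_space (ground :: ('k::field, 'k) vs)"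
proof -
  interpret vector_space "(*) :: 'k \<Rightarrow> 'k \<Rightarrow> 'k" by standard (auto simp: algebra_simps)
  show ?thesis by (simp add: k_space_def ground_def vector_space_axioms)
qed

lemma k_space_smul:
  assumes "k_space X"
  shows "smul X a (x + y) = smul X a x + smul X a y"
    and "smul X (a + b) x = smul X a x + smul X b x"
    and "smul X a (smul X b x) = smul X (a * b) x"
    and "smul X 1 x = x" and "smul X 0 x = 0" and "smul X a 0 = 0"
proof -
  interpret vector_space "smul X" using assms by (simp add: k_space_def)
  show "smul X a (x + y) = smul X a x + smul X a y"
    and "smul X (a + b) x = smul X a x + smul X b x"
    and "smul X a (smul X b x) = smul X (a * b) x"
    and "smul X 1 x = x" and "smul X 0 x = 0" and "smul X a 0 = 0"
    by (simp_all add: scale_right_distrib scale_left_distrib)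
qed

lemma smul_tensor: "smul (tensor X Y) = tscale"
  by (simp add: tensor_def)

lemma mem_ground: "c \<in> carr ground"
  by (simp add: ground_def)

lemma lin_ident: "lin X X (\<lambda>x. x)"
  by (simp add: lin_def)

lemma lin_zero:
  assumes "k_space X" and "k_space Y" and "lin X Y f"
  shows "f 0 = 0"
  using linD(3)[OF assms(3) k_spaceD(1)[OF assms(1)], of 0] k_space_smul(5)[OF assms(1)]
    k_space_smul(5)[OF assms(2)] by metis

lemma lin_comp:
  assumes "lin Y Z g" and "lin X Y f"
  shows "lin X Z (\<lambda>x. g (f x))"
  using assms by (simp add: lin_def)

text \<open>The argument that carries the variable is kept as a separate linear map
  \<open>f\<close>, so that resolution strips the outermost operation of a nested expression and
  continues with \<open>f\<close>.\<close>

lemma bilin_comp1: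
  assumes "bilin Y Y' Z g" and "lin X Y f" and "y \<in> carr Y'"
  shows "lin X Z (\<lambda>x. g (f x) y)"
  using assms by (simp add: lin_def bilin_def)

lemma bilin_comp2:
  assumes "bilin Y Y' Z g" and "lin X Y' f" and "y \<in> carr Y"
  shows "lin X Z (\<lambda>x. g y (f x))"
  using assms by (simp add: lin_def bilin_def)

lemma bilin_mem: "bilin X Y Z B \<Longrightarrow> x \<in> carr X \<Longrightarrow> y \<in> carr Y \<Longrightarrow> B x y \<in> carr Z"
  by (simp add: lin_def bilin_def)

lemmas lin_tens1 = bilin_comp1[OF bilin_tens]
lemmas lin_tens2 = bilin_comp2[OF bilin_tens]
lemmas tens_mem = bilin_mem[OF bilin_tens]

lemma lin_add:
  assumes "k_space Y" and "lin X Y f" and "lin X Y g"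
  shows "lin X Y (\<lambda>x. f x + g x)"
  using assms by (auto simp: lin_def k_space_smul k_spaceD algebra_simps)

lemma bilin_smul: "k_space X \<Longrightarrow> bilin ground X X (smul X)"
  by (auto simp: bilin_def lin_def ground_def k_spaceD k_space_smul mult.commute)

lemmas lin_smul1 = bilin_comp1[OF bilin_smul]
lemmas lin_smul2 = bilin_comp2[OF bilin_smul _ mem_ground]
lemmas lin_tscale1 = lin_smul1[OF k_space_tensor, unfolded smul_tensor]
lemmas lin_tscale2 = lin_smul2[OF k_space_tensor, unfolded smul_tensor]
lemmas tscale_mem = k_spaceD(3)[OF k_space_tensor, unfolded smul_tensor]

lemma lin_mult1: "lin X ground f \<Longrightarrow> lin X ground (\<lambda>x. f x * c)"
  and lin_mult2: "lin X ground f \<Longrightarrow> lin X ground (\<lambda>x. c * f x)"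
  by (auto simp: lin_def ground_def algebra_simps)

section \<open>Calculus of Sweedler sums\<close>

text \<open>The description in \<open>sweedler_def\<close> sums only over pairs from the carriers,
  so values elsewhere do not matter. As a congruence rule this hands the membership of the bound
  variables to the simplifier.\<close>

lemma sweedler_cong:
  assumes "t = t'" and "\<And>x y. x \<in> carr X \<Longrightarrow> y \<in> carr Y \<Longrightarrow> B x y = B' x y"
  shows "sweedler X Y t B = sweedler X Y t' B'"
proof -
  have "(\<Sum>(x, y)\<leftarrow>ps. B x y) = (\<Sum>(x, y)\<leftarrow>ps. B' x y)" if "set ps \<subseteq> carr X \<times> carr Y" for ps
    using that assms(2) by (induction ps) auto
  then show ?thesis unfolding sweedler_def assms(1) by (intro arg_cong[where f = The] ext) metis
qed

lemma lin_sweedler1: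
  assumes "k_space P" and "k_space Z" and "lin X (tensor P Q) t" and "bilin P Q Z B"
  shows "lin X Z (\<lambda>x. sweedler P Q (t x) B)"
  by (rule lin_comp[OF lin_sweedler[OF assms(1,2,4)] assms(3)])

text \<open>Here the tensor is fixed and the summand depends on the parameter. One decomposition of
  \<open>t\<close> into pure tensors serves for every \<open>x\<close>, and what remains is a finite
  sum of linear maps.\<close>

lemma lin_sweedler2:
  assumes "k_space P" and "k_space Z" and "k_space X" and t: "t \<in> carr (tensor P Q)"
    and B: "\<And>x. x \<in> carr X \<Longrightarrow> bilin P Q Z (B x)"
    and l: "\<And>p q. p \<in> carr P \<Longrightarrow> q \<in> carr Q \<Longrightarrow> lin X Z (\<lambda>x. B x p q)"
  shows "lin X Z (\<lambda>x. sweedler P Q t (B x))"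
proof -
  obtain ps where ps: "set ps \<subseteq> carr P \<times> carr Q" "t = (\<Sum>(x, y)\<leftarrow>ps. tens P Q x y)"
    using tensor_sum[OF assms(1) t] by blast
  have *: "sweedler P Q t (B x) = (\<Sum>(p, q)\<leftarrow>ps. B x p q)" if "x \<in> carr X" for x
    using sweedler_sum[OF assms(2) B[OF that] ps(1)] ps(2) by simp
  have "lin X Z (\<lambda>x. \<Sum>(p, q)\<leftarrow>ps. B x p q)" using ps(1)
  proof (induction ps)
    case Nil
    show ?case using assms(2) by (simp add: lin_def k_spaceD k_space_smul)
  next
    case (Cons a ps)
    then show ?case by (cases a) (auto intro!: lin_add assms l)
  qed
  then show ?thesis using * by (simp add: lin_def k_spaceD[OF assms(3)])
qed

lemma sweedler_mem:
  assumes "k_space P" and "k_space Z" and "t \<in> carr (tensor P Q)" and "bilin P Q Z B"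
  shows "sweedler P Q t B \<in> carr Z"
  using linD(1)[OF lin_sweedler[OF assms(1,2,4)] assms(3)] .

text \<open>Both sides are linear in \<open>t\<close> and agree on pure tensors. Most of the
  \<open>pull_out\<close> rules are instances of this.\<close>

lemma lin_sweedler_apply:
  assumes "k_space P" and "k_space Y" and "k_space Z" and "lin Y Z f"
    and "t \<in> carr (tensor P Q)" and F: "bilin P Q Y F"
  shows "f (sweedler P Q t F) = sweedler P Q t (\<lambda>p q. f (F p q))"
proof (rule tensor_lin_unique[OF assms(1,3) _ _ _ assms(5)])
  have B: "bilin P Q Z (\<lambda>p q. f (F p q))"
    using F assms(4) by (auto intro!: bilinI lin_comp[OF assms(4)] dest: bilinD)
  show "lin (tensor P Q) Z (\<lambda>t. sweedler P Q t (\<lambda>p q. f (F p q)))"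
    by (rule lin_sweedler[OF assms(1,3) B])
  show "lin (tensor P Q) Z (\<lambda>t. f (sweedler P Q t F))"
    by (rule lin_comp[OF assms(4) lin_sweedler[OF assms(1,2) F]])
  show "f (sweedler P Q (tens P Q p q) F) = sweedler P Q (tens P Q p q) (\<lambda>p q. f (F p q))"
    if "p \<in> carr P" "q \<in> carr Q" for p q
    using that by (simp add: sweedler_tens[OF assms(3) B] sweedler_tens[OF assms(2) F])
qed

lemma sweedler_sweedler:
  assumes "k_space P" and "k_space X" and "k_space Z" and "bilin X Y Z B"
    and "t \<in> carr (tensor P Q)" and "bilin P Q (tensor X Y) F"
  shows "sweedler X Y (sweedler P Q t F) B = sweedler P Q t (\<lambda>p q. sweedler X Y (F p q) B)"
  by (rule lin_sweedler_apply[OF assms(1) k_space_tensor assms(3) lin_sweedler[OF assms(2-4)] assms(5,6)])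

text \<open>Interchange of two independent finite sums: by linearity in \<open>t\<close> it suffices
  to take \<open>t\<close> pure, where one of the sums collapses.\<close>

lemma sweedler_swap:
  assumes P: "k_space P" and X: "k_space X" and Z: "k_space Z"
    and t: "t \<in> carr (tensor P Q)" and u: "u \<in> carr (tensor X Y)"
    and B1: "\<And>p q. p \<in> carr P \<Longrightarrow> q \<in> carr Q \<Longrightarrow> bilin X Y Z (\<lambda>x y. B p q x y)"
    and B2: "\<And>x y. x \<in> carr X \<Longrightarrow> y \<in> carr Y \<Longrightarrow> bilin P Q Z (\<lambda>p q. B p q x y)"
    and Q: "k_space Q" and Y: "k_space Y"
  shows "sweedler P Q t (\<lambda>p q. sweedler X Y u (\<lambda>x y. B p q x y)) =
    sweedler X Y u (\<lambda>x y. sweedler P Q t (\<lambda>p q. B p q x y))"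
proof (rule tensor_lin_unique[OF P Z _ _ _ t])
  have B: "bilin P Q Z (\<lambda>p q. sweedler X Y u (\<lambda>x y. B p q x y))"
    by (intro bilinI lin_sweedler2 assms bilinD(1)[OF B2] bilinD(2)[OF B2])
  show "lin (tensor P Q) Z (\<lambda>t. sweedler P Q t (\<lambda>p q. sweedler X Y u (\<lambda>x y. B p q x y)))"
    by (rule lin_sweedler[OF P Z B])
  have B': "bilin X Y Z (\<lambda>x y. sweedler P Q t (\<lambda>p q. B p q x y))" if "t \<in> carr (tensor P Q)" for t
    by (intro bilinI lin_sweedler2 assms that bilinD(1)[OF B1] bilinD(2)[OF B1])
  show "lin (tensor P Q) Z (\<lambda>t. sweedler X Y u (\<lambda>x y. sweedler P Q t (\<lambda>p q. B p q x y)))"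
    by (intro lin_sweedler2 k_space_tensor assms B' lin_sweedler B2)
  show "sweedler P Q (tens P Q p q) (\<lambda>p q. sweedler X Y u (\<lambda>x y. B p q x y)) =
    sweedler X Y u (\<lambda>x y. sweedler P Q (tens P Q p q) (\<lambda>p q. B p q x y))"
    if "p \<in> carr P" "q \<in> carr Q" for p q
    using that by (simp add: sweedler_tens[OF Z B] sweedler_tens[OF Z B2] cong: sweedler_cong)
qed

lemma lin_mem: "lin X Y f \<Longrightarrow> x \<in> carr X \<Longrightarrow> f x \<in> carr Y"
  by (rule linD)

lemmas [lin_rules] = bilinI k_space_ground k_space_tensor lin_ident lin_tens1 lin_tens2 tens_mem
  lin_smul1 lin_smul2 k_spaceD(3) lin_tscale1 lin_tscale2 tscale_mem lin_mult1 lin_mult2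
  mem_ground lin_sweedler1 lin_sweedler2 sweedler_mem

lemma bilin_sweedler1:
  assumes "bilin X Y Z B" and "k_space X" and "k_space Z"
    and "k_space P" and "t \<in> carr (tensor P Q)" and "bilin P Q X F" and "y \<in> carr Y"
  shows "B (sweedler P Q t F) y = sweedler P Q t (\<lambda>p q. B (F p q) y)"
  by (rule lin_sweedler_apply[OF assms(4,2,3) bilinD(2)[OF assms(1,7)] assms(5,6)])

lemma bilin_sweedler2:
  assumes "bilin X Y Z B" and "k_space Y" and "k_space Z"
    and "k_space P" and "t \<in> carr (tensor P Q)" and "bilin P Q Y F" and "x \<in> carr X"
  shows "B x (sweedler P Q t F) = sweedler P Q t (\<lambda>p q. B x (F p q))"
  by (rule lin_sweedler_apply[OF assms(4,2,3) bilinD(1)[OF assms(1,7)] assms(5,6)])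

lemma bilin_scale:
  assumes "bilin X Y Z B" and "x \<in> carr X" and "y \<in> carr Y"
  shows "B (smul X c x) y = smul Z c (B x y)" and "B x (smul Y c y) = smul Z c (B x y)"
  using assms by (simp_all add: bilin_def lin_def)

lemmas [pull_out] = bilin_sweedler1[OF bilin_tens _ k_space_tensor] bilin_sweedler2[OF bilin_tens _ k_space_tensor]
  bilin_sweedler1[OF bilin_smul k_space_ground] bilin_sweedler2[OF bilin_smul _ _ _ _ _ mem_ground]
  bilin_scale[OF bilin_tens, unfolded smul_tensor] k_space_smul(3)
  k_space_smul(3)[OF k_space_tensor, unfolded smul_tensor]
  bilin_sweedler1[OF bilin_smul[OF k_space_tensor] k_space_ground, unfolded smul_tensor]
  bilin_sweedler2[OF bilin_smul[OF k_space_tensor] _ _ _ _ _ mem_ground, unfolded smul_tensor]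

lemma sweedler_mult:
  fixes c :: "'k::field"
  assumes "k_space P" and "t \<in> carr (tensor P Q)" and F: "bilin P Q ground F"
  shows "c * sweedler P Q t F = sweedler P Q t (\<lambda>p q. c * F p q)"
    and "sweedler P Q t F * c = sweedler P Q t (\<lambda>p q. F p q * c)"
  using lin_sweedler_apply[OF assms(1) k_space_ground k_space_ground lin_mult2[OF lin_ident] assms(2,3)]
    lin_sweedler_apply[OF assms(1) k_space_ground k_space_ground lin_mult1[OF lin_ident] assms(2,3)]
  by simp_all

declare sweedler_mult [pull_out]

section \<open>Trilinear maps and coassociativity\<close>

definition trilin ::
  "('k::field, 'a::ab_group_add, 'm) vs_scheme \<Rightarrow> ('k, 'b::ab_group_add, 'n) vs_scheme
    \<Rightarrow> ('k, 'c::ab_group_add, 'o) vs_scheme \<Rightarrow> ('k, 'd::ab_group_add, 'p) vs_scheme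
    \<Rightarrow> ('a \<Rightarrow> 'b \<Rightarrow> 'c \<Rightarrow> 'd) \<Rightarrow> bool"
  where "trilin X Y W Z T \<longleftrightarrow> (\<forall>x\<in>carr X. bilin Y W Z (T x)) \<and>
    (\<forall>y\<in>carr Y. \<forall>w\<in>carr W. lin X Z (\<lambda>x. T x y w))"

lemma trilinI:
  assumes "\<And>x y. x \<in> carr X \<Longrightarrow> y \<in> carr Y \<Longrightarrow> lin W Z (\<lambda>w. T x y w)"
    and "\<And>x w. x \<in> carr X \<Longrightarrow> w \<in> carr W \<Longrightarrow> lin Y Z (\<lambda>y. T x y w)"
    and "\<And>y w. y \<in> carr Y \<Longrightarrow> w \<in> carr W \<Longrightarrow> lin X Z (\<lambda>x. T x y w)"
  shows "trilin X Y W Z T"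
  using assms by (simp add: trilin_def bilin_def)

lemma trilin_comp:
  assumes "trilin X Y W Z T"
  shows "lin U X f \<Longrightarrow> y \<in> carr Y \<Longrightarrow> w \<in> carr W \<Longrightarrow> lin U Z (\<lambda>u. T (f u) y w)"
    and "lin U Y g \<Longrightarrow> x \<in> carr X \<Longrightarrow> w \<in> carr W \<Longrightarrow> lin U Z (\<lambda>u. T x (g u) w)"
    and "lin U W h \<Longrightarrow> x \<in> carr X \<Longrightarrow> y \<in> carr Y \<Longrightarrow> lin U Z (\<lambda>u. T x y (h u))"
    and "x \<in> carr X \<Longrightarrow> y \<in> carr Y \<Longrightarrow> w \<in> carr W \<Longrightarrow> T x y w \<in> carr Z"
  using assms by (simp_all add: trilin_def bilin_def lin_def)

declare trilinI [lin_rules]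

text \<open>A coassociativity law, stated as an identity in \<open>X \<otimes> (Y \<otimes> W)\<close>, is used by testing it against
  trilinear maps.\<close>

lemma coassoc_test:
  assumes X [lin_rules]: "k_space X" and Y [lin_rules]: "k_space Y" and W [lin_rules]: "k_space W"
    and Z [lin_rules]: "k_space Z"
    and t [lin_rules]: "t \<in> carr (tensor X W)" and g: "lin W (tensor Y W) g" and h: "lin X (tensor X Y) h"
    and eq: "sweedler X W t (\<lambda>x w. tens X (tensor Y W) x (g w)) =
      sweedler X W t (\<lambda>x w. sweedler X Y (h x) (\<lambda>x' y. tens X (tensor Y W) x' (tens Y W y w)))"
    and T: "trilin X Y W Z T"
  shows "sweedler X W t (\<lambda>x w. sweedler Y W (g w) (\<lambda>y w'. T x y w')) =
    sweedler X W t (\<lambda>x w. sweedler X Y (h x) (\<lambda>x' y. T x' y w))"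
proof -
  note [lin_rules] = trilin_comp[OF T] lin_comp[OF g] lin_comp[OF h] lin_mem[OF g] lin_mem[OF h]
  \<comment> \<open>\<open>E\<close> is the linear map on X \<otimes> (Y \<otimes> W) induced by
    \<open>T\<close>. The claim is \<open>E\<close> applied to both sides of \<open>eq\<close>,
    pushed through the Sweedler sums.\<close>
  define E where "E u = sweedler X (tensor Y W) u (\<lambda>x v. sweedler Y W v (\<lambda>y w. T x y w))" for u
  have E: "lin (tensor X (tensor Y W)) Z E"
    unfolding E_def by (assumption | rule lin_rules)+
  have Et: "E (tens X (tensor Y W) x v) = sweedler Y W v (\<lambda>y w. T x y w)"
    if "x \<in> carr X" "v \<in> carr (tensor Y W)" for x v
    unfolding E_def by (rule sweedler_tens[OF Z]) (assumption | rule lin_rules that)+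
  have "sweedler X W t (\<lambda>x w. sweedler Y W (g w) (\<lambda>y w. T x y w)) =
      sweedler X W t (\<lambda>x w. E (tens X (tensor Y W) x (g w)))"
    by (rule sweedler_cong[OF refl]) (simp add: Et linD(1)[OF g])
  also have "\<dots> = E (sweedler X W t (\<lambda>x w. tens X (tensor Y W) x (g w)))"
    by (rule lin_sweedler_apply[symmetric, OF _ _ _ E]) (assumption | rule lin_rules)+
  also have "\<dots> = sweedler X W t (\<lambda>x w. E (sweedler X Y (h x) (\<lambda>x' y. tens X (tensor Y W) x' (tens Y W y w))))"
    unfolding eq by (rule lin_sweedler_apply[OF _ _ _ E]) (assumption | rule lin_rules)+
  also have "\<dots> = sweedler X W t (\<lambda>x w. sweedler X Y (h x) (\<lambda>x' y. T x' y w))"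
  proof (rule sweedler_cong[OF refl])
    fix x w assume [lin_rules]: "x \<in> carr X" "w \<in> carr W"
    have "E (sweedler X Y (h x) (\<lambda>x' y. tens X (tensor Y W) x' (tens Y W y w))) =
      sweedler X Y (h x) (\<lambda>x' y. E (tens X (tensor Y W) x' (tens Y W y w)))"
      by (rule lin_sweedler_apply[OF _ _ _ E]) (assumption | rule lin_rules)+
    also have "\<dots> = sweedler X Y (h x) (\<lambda>x' y. T x' y w)"
    proof (rule sweedler_cong[OF refl])
      fix x' y assume [lin_rules]: "x' \<in> carr X" "y \<in> carr Y"
      show "E (tens X (tensor Y W) x' (tens Y W y w)) = T x' y w"
        unfolding Et[OF \<open>x' \<in> carr X\<close> tens_mem[OF \<open>y \<in> carr Y\<close> \<open>w \<in> carr W\<close>]]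
        by (rule sweedler_tens[OF Z]) (assumption | rule lin_rules)+
    qed
    finally show "E (sweedler X Y (h x) (\<lambda>x' y. tens X (tensor Y W) x' (tens Y W y w))) =
      sweedler X Y (h x) (\<lambda>x' y. T x' y w)" .
  qed
  finally show ?thesis .
qed

section \<open>Smash products of left coideal subalgebras\<close>

text \<open>\<open>\<delta>\<close> is the coproduct of \<open>A\<close> on \<open>R\<close> with
  its second leg corestricted to \<open>R\<close>, and \<open>P\<close> is a linear retraction of
  the inclusion \<open>i\<close>. Of \<open>A\<close> itself only multilinearity of the operations
  is recorded. The algebraic laws are carried by \<open>R\<close> and \<open>\<delta>\<close>, so a
  bosonization fits in without first being proved a Hopf algebra.\<close>

locale left_coideal =
  fixes A :: "('k::field, 'a::ab_group_add, 'm) bialg_scheme"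
    and R :: "('k, 'r::ab_group_add, 'n) alg_scheme"
    and \<delta> :: "'r \<Rightarrow> ('k, 'a, 'r) tens"
    and i :: "'r \<Rightarrow> 'a" and P :: "'a \<Rightarrow> 'r"
  assumes k_space_A: "k_space A" and bilin_mul_A: "bilin A A A (mul A)"
    and unity_A: "unity A \<in> carr A" 
    and lin_comul_A: "lin A (tensor A A) (comul A)" and lin_counit_A: "lin A ground (counit A)"
    and algebra_R: "algebra R"
    and lin_coact: "lin R (tensor A R) \<delta>"
    and coact_unity: "\<delta> (unity R) = tens A R (unity A) (unity R)"
    and coact_mul: "r \<in> carr R \<Longrightarrow> s \<in> carr R \<Longrightarrow> \<delta> (mul R r s) =
      sweedler A R (\<delta> r) (\<lambda>\<alpha> p. sweedler A R (\<delta> s) (\<lambda>\<beta> q. tens A R (mul A \<alpha> \<beta>) (mul R p q)))"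
    and coact_coassoc: "r \<in> carr R \<Longrightarrow> sweedler A R (\<delta> r) (\<lambda>\<alpha> p. tens A (tensor A R) \<alpha> (\<delta> p)) =
      sweedler A R (\<delta> r) (\<lambda>\<alpha> p. sweedler A A (comul A \<alpha>) (\<lambda>\<alpha>1 \<alpha>2. tens A (tensor A R) \<alpha>1 (tens A R \<alpha>2 p)))"
    and coact_counit: "r \<in> carr R \<Longrightarrow> sweedler A R (\<delta> r) (\<lambda>\<alpha> p. smul R (counit A \<alpha>) p) = r"
    and lin_incl: "lin R A i" and incl_unity: "i (unity R) = unity A"
    and incl_mul: "r \<in> carr R \<Longrightarrow> s \<in> carr R \<Longrightarrow> i (mul R r s) = mul A (i r) (i s)"
    and incl_comul: "r \<in> carr R \<Longrightarrow> comul A (i r) = sweedler A R (\<delta> r) (\<lambda>\<alpha> p. tens A A \<alpha> (i p))"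
    and lin_proj: "lin A R P" and proj_incl: "r \<in> carr R \<Longrightarrow> P (i r) = r"
begin

lemma k_space_R: "k_space R" and bilin_mul_R: "bilin R R R (mul R)" and unity_R: "unity R \<in> carr R"
  using algebra_R by (simp_all add: algebra_def)

lemma mul_assoc: "x \<in> carr R \<Longrightarrow> y \<in> carr R \<Longrightarrow> z \<in> carr R \<Longrightarrow> mul R (mul R x y) z = mul R x (mul R y z)"
  and mul_unity [simp]: "x \<in> carr R \<Longrightarrow> mul R (unity R) x = x" "x \<in> carr R \<Longrightarrow> mul R x (unity R) = x"
  using algebra_R by (simp_all add: algebra_def)

lemmas [lin_rules] = k_space_A unity_A k_space_R unity_R
  bilin_comp1[OF bilin_mul_A] bilin_comp2[OF bilin_mul_A] bilin_mem[OF bilin_mul_A]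
  bilin_comp1[OF bilin_mul_R] bilin_comp2[OF bilin_mul_R] bilin_mem[OF bilin_mul_R]
  lin_comp[OF lin_comul_A] lin_mem[OF lin_comul_A] lin_comp[OF lin_counit_A]
  lin_comp[OF lin_coact] lin_mem[OF lin_coact] lin_comp[OF lin_incl] lin_mem[OF lin_incl]
  lin_comp[OF lin_proj] lin_mem[OF lin_proj]

lemmas [pull_out] = bilin_sweedler1[OF bilin_mul_A k_space_A k_space_A] bilin_sweedler2[OF bilin_mul_A k_space_A k_space_A]
  bilin_sweedler1[OF bilin_mul_R k_space_R k_space_R] bilin_sweedler2[OF bilin_mul_R k_space_R k_space_R]
  bilin_scale[OF bilin_mul_A] bilin_scale[OF bilin_mul_R]
  lin_sweedler_apply[OF _ k_space_R k_space_A lin_incl] linD(3)[OF lin_incl]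
  lin_sweedler_apply[OF _ k_space_R k_space_tensor lin_coact] linD(3)[OF lin_coact, unfolded smul_tensor]
  lin_sweedler_apply[OF _ k_space_A k_space_tensor lin_comul_A] linD(3)[OF lin_comul_A, unfolded smul_tensor]
  lin_sweedler_apply[OF _ k_space_A k_space_R lin_proj] linD(3)[OF lin_proj]

lemmas coassoc = coassoc_test[OF k_space_A k_space_A k_space_R _ lin_mem[OF lin_coact] lin_coact
    lin_comul_A coact_coassoc]

end

section \<open>The module algebra action induced by a skew pairing\<close>

locale coideal_pair = A: left_coideal A R \<delta> i P + H: left_coideal H S \<epsilon> j Q
  for A :: "('k::field, 'a::ab_group_add, 'm) bialg_scheme"
    and R :: "('k, 'r::ab_group_add, 'n) alg_scheme" and \<delta> i P
    and H :: "('k, 'h::ab_group_add, 'm1) bialg_scheme"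
    and S :: "('k, 's::ab_group_add, 'n1) alg_scheme" and \<epsilon> j Q +
  fixes \<tau> :: "'a \<Rightarrow> 'h \<Rightarrow> 'k"
  assumes pairing: "skew_pairing A H \<tau>"
begin

lemma bilin_pairing: "bilin A H ground \<tau>"
  and pairing_mul1: "\<alpha> \<in> carr A \<Longrightarrow> \<beta> \<in> carr A \<Longrightarrow> x \<in> carr H \<Longrightarrow>
    \<tau> (mul A \<alpha> \<beta>) x = sweedler H H (comul H x) (\<lambda>x1 x2. \<tau> \<alpha> x1 * \<tau> \<beta> x2)"
  and pairing_mul2: "\<alpha> \<in> carr A \<Longrightarrow> x \<in> carr H \<Longrightarrow> y \<in> carr H \<Longrightarrow>
    \<tau> \<alpha> (mul H x y) = sweedler A A (comul A \<alpha>) (\<lambda>\<alpha>1 \<alpha>2. \<tau> \<alpha>1 y * \<tau> \<alpha>2 x)"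
  and pairing_unity1: "x \<in> carr H \<Longrightarrow> \<tau> (unity A) x = counit H x"
  and pairing_unity2: "\<alpha> \<in> carr A \<Longrightarrow> \<tau> \<alpha> (unity H) = counit A \<alpha>"
  using pairing by (simp_all add: skew_pairing_def)

lemmas [lin_rules] = bilin_comp1[OF bilin_pairing] bilin_comp2[OF bilin_pairing]

lemmas [pull_out] = bilin_sweedler1[OF bilin_pairing A.k_space_A k_space_ground]
  bilin_sweedler2[OF bilin_pairing H.k_space_A k_space_ground]

definition lact :: "'h \<Rightarrow> 'r \<Rightarrow> 'r" where
  "lact x r = sweedler A R (\<delta> r) (\<lambda>\<alpha> p. smul R (\<tau> \<alpha> x) p)"

lemma bilin_lact: "bilin H R R lact"
  unfolding lact_def by (assumption | rule lin_rules)+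

lemmas [lin_rules] = bilin_comp1[OF bilin_lact] bilin_comp2[OF bilin_lact] bilin_mem[OF bilin_lact]

lemmas [pull_out] = bilin_sweedler1[OF bilin_lact H.k_space_A A.k_space_R]
  bilin_sweedler2[OF bilin_lact A.k_space_R A.k_space_R] bilin_scale[OF bilin_lact]

text \<open>By \<open>A.incl_comul\<close> the coproduct of \<open>i r\<close> is
  \<open>\<delta> r\<close> with \<open>i\<close> applied to the second leg, while pairing with
  \<open>x\<close> consumes only the first leg.\<close>

lemma incl_lact:
  assumes "x \<in> carr H" and "r \<in> carr R"
  shows "i (lact x r) = hact A \<tau> x (i r)"
  by (simp add: lact_def hact_def assms A.incl_comul sweedler_sweedler[where Z=A]
      sweedler_tens[where Z=A] lin_rules pull_out cong: sweedler_cong)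

text \<open>\<open>pairing_mul2\<close> reverses the factors in the second argument. With
  coassociativity of \<open>\<delta>\<close>, the factor \<open>y\<close> meets the outer leg and
  acts first, as a left action requires.\<close>

lemma lact_mul:
  assumes "x \<in> carr H" and "y \<in> carr H" and "r \<in> carr R"
  shows "lact (mul H x y) r = lact x (lact y r)"
proof -
  have "lact (mul H x y) r = sweedler A R (\<delta> r) (\<lambda>\<alpha> p. sweedler A A (comul A \<alpha>) (\<lambda>\<alpha>1 \<alpha>2. smul R (\<tau> \<alpha>1 y * \<tau> \<alpha>2 x) p))"
    by (simp add: lact_def assms pairing_mul2 lin_rules pull_out cong: sweedler_cong)
  also have "\<dots> = sweedler A R (\<delta> r) (\<lambda>\<alpha> p. sweedler A R (\<delta> p) (\<lambda>\<beta> q. smul R (\<tau> \<alpha> y * \<tau> \<beta> x) q))"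
    by (rule A.coassoc[symmetric]) (assumption | rule lin_rules assms)+
  also have "\<dots> = sweedler A R (\<delta> r) (\<lambda>\<alpha> p. smul R (\<tau> \<alpha> y) (lact x p))"
    by (simp add: lact_def assms lin_rules pull_out cong: sweedler_cong)
  also have "\<dots> = lact x (lact y r)"
    unfolding lact_def[of y] by (simp add: assms lin_rules pull_out cong: sweedler_cong)
  finally show ?thesis .
qed

lemma lact_unity: "r \<in> carr R \<Longrightarrow> lact (unity H) r = r"
  by (simp add: lact_def pairing_unity2 A.coact_counit cong: sweedler_cong)

lemma lact_on_unity: "x \<in> carr H \<Longrightarrow> lact x (unity R) = smul R (counit H x) (unity R)"
  by (simp add: lact_def A.coact_unity sweedler_tens[where Z=R] lin_rules pairing_unity1)

text \<open>\<open>\<delta>\<close> is multiplicative, and the pairing turns a product in its first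
  argument into the coproduct of \<open>x\<close>. The interchanges only move that coproduct to the
  outermost position.\<close>

lemma lact_on_mul:
  assumes "x \<in> carr H" and "r \<in> carr R" and "s \<in> carr R"
  shows "lact x (mul R r s) = sweedler H H (comul H x) (\<lambda>x1 x2. mul R (lact x1 r) (lact x2 s))"
proof -
  have "lact x (mul R r s) = sweedler A R (\<delta> r) (\<lambda>\<alpha> p. sweedler A R (\<delta> s) (\<lambda>\<beta> q.
      sweedler H H (comul H x) (\<lambda>x1 x2. smul R (\<tau> \<alpha> x1 * \<tau> \<beta> x2) (mul R p q))))"
    by (simp add: lact_def assms A.coact_mul pairing_mul1 sweedler_sweedler[where Z=R] sweedler_tens[where Z=R]
        lin_rules pull_out cong: sweedler_cong)
  also have "\<dots> = sweedler A R (\<delta> r) (\<lambda>\<alpha> p. sweedler H H (comul H x) (\<lambda>x1 x2. sweedler A R (\<delta> s) (\<lambda>\<beta> q.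
      smul R (\<tau> \<alpha> x1 * \<tau> \<beta> x2) (mul R p q))))"
    by (intro sweedler_cong refl sweedler_swap[where Z=R]) (assumption | rule lin_rules assms)+
  also have "\<dots> = sweedler H H (comul H x) (\<lambda>x1 x2. sweedler A R (\<delta> r) (\<lambda>\<alpha> p. sweedler A R (\<delta> s) (\<lambda>\<beta> q.
      smul R (\<tau> \<alpha> x1 * \<tau> \<beta> x2) (mul R p q))))"
    by (rule sweedler_swap[where Z=R]) (assumption | rule lin_rules assms)+
  \<comment> \<open>This puts the two coactions in the order in which \<open>pull_out\<close>
    extracts them from the product of the two actions.\<close>
  also have "\<dots> = sweedler H H (comul H x) (\<lambda>x1 x2. sweedler A R (\<delta> s) (\<lambda>\<beta> q. sweedler A R (\<delta> r) (\<lambda>\<alpha> p.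
      smul R (\<tau> \<alpha> x1 * \<tau> \<beta> x2) (mul R p q))))"
    by (intro sweedler_cong refl sweedler_swap[where Z=R]) (assumption | rule lin_rules assms)+
  also have "\<dots> = sweedler H H (comul H x) (\<lambda>x1 x2. mul R (lact x1 r) (lact x2 s))"
    by (simp add: lact_def assms lin_rules pull_out mult.commute cong: sweedler_cong)
  finally show ?thesis .
qed

text \<open>The product of the smash product, transported to \<open>R \<otimes> S\<close>.\<close>

definition boson :: "('k, 'r, 's) tens \<Rightarrow> ('k, 'r, 's) tens \<Rightarrow> ('k, 'r, 's) tens" where
  "boson z z' = sweedler R S z (\<lambda>r s. sweedler R S z' (\<lambda>r' s'.
    sweedler H S (\<epsilon> s) (\<lambda>x p. tens R S (mul R r (lact x r')) (mul S p s'))))"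

lemma bilin_boson: "bilin (tensor R S) (tensor R S) (tensor R S) boson"
  unfolding boson_def by (assumption | rule lin_rules)+

lemmas [lin_rules] = bilin_comp1[OF bilin_boson] bilin_comp2[OF bilin_boson] bilin_mem[OF bilin_boson]

lemmas [pull_out] = bilin_sweedler1[OF bilin_boson k_space_tensor k_space_tensor]
  bilin_sweedler2[OF bilin_boson k_space_tensor k_space_tensor] bilin_scale[OF bilin_boson, unfolded smul_tensor]

lemma boson_tens:
  assumes "r \<in> carr R" and "s \<in> carr S" and "r' \<in> carr R" and "s' \<in> carr S"
  shows "boson (tens R S r s) (tens R S r' s') =
    sweedler H S (\<epsilon> s) (\<lambda>x p. tens R S (mul R r (lact x r')) (mul S p s'))"
  by (simp add: boson_def assms sweedler_tens[where Z="tensor R S"] lin_rules)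

text \<open>On the left, \<open>s\<close> is split by coacting twice. On the right, its
  \<open>H\<close>-component acts on a product in \<open>R\<close> and is split by the coproduct of
  \<open>H\<close>. Coassociativity of \<open>\<epsilon>\<close> identifies the two.\<close>

lemma boson_assoc_tens:
  assumes [lin_rules]: "r \<in> carr R" "s \<in> carr S" "r' \<in> carr R" "s' \<in> carr S" "r'' \<in> carr R" "s'' \<in> carr S"
  shows "boson (boson (tens R S r s) (tens R S r' s')) (tens R S r'' s'') =
    boson (tens R S r s) (boson (tens R S r' s') (tens R S r'' s''))"
proof -
  have "boson (boson (tens R S r s) (tens R S r' s')) (tens R S r'' s'') =
     sweedler H S (\<epsilon> s) (\<lambda>x p. sweedler H S (\<epsilon> p) (\<lambda>y q. sweedler H S (\<epsilon> s') (\<lambda>z t.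
       tens R S (mul R (mul R r (lact x r')) (lact (mul H y z) r'')) (mul S (mul S q t) s''))))"
    by (simp add: boson_tens H.coact_mul sweedler_sweedler[where Z="tensor R S"] sweedler_tens[where Z="tensor R S"] 
       lin_rules pull_out cong: sweedler_cong)
  also have "\<dots> = sweedler H S (\<epsilon> s) (\<lambda>x p. sweedler H H (comul H x) (\<lambda>x1 x2. sweedler H S (\<epsilon> s') (\<lambda>z t.
       tens R S (mul R (mul R r (lact x1 r')) (lact (mul H x2 z) r'')) (mul S (mul S p t) s''))))"
    by (rule H.coassoc) (assumption | rule lin_rules)+
  also have "\<dots> = sweedler H S (\<epsilon> s) (\<lambda>x p. sweedler H S (\<epsilon> s') (\<lambda>z t. sweedler H H (comul H x) (\<lambda>x1 x2.
       tens R S (mul R (mul R r (lact x1 r')) (lact (mul H x2 z) r'')) (mul S (mul S p t) s''))))"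
    by (intro sweedler_cong refl sweedler_swap[where Z="tensor R S"]) (assumption | rule lin_rules)+
  also have "\<dots> = sweedler H S (\<epsilon> s') (\<lambda>z t. sweedler H S (\<epsilon> s) (\<lambda>x p. sweedler H H (comul H x) (\<lambda>x1 x2.
       tens R S (mul R (mul R r (lact x1 r')) (lact (mul H x2 z) r'')) (mul S (mul S p t) s''))))"
    by (rule sweedler_swap[where Z="tensor R S"]) (assumption | rule lin_rules)+
  also have "\<dots> = boson (tens R S r s) (boson (tens R S r' s') (tens R S r'' s''))"
    by (simp add: boson_tens lact_mul lact_on_mul A.mul_assoc H.mul_assoc lin_rules pull_out cong: sweedler_cong)
  finally show ?thesis .
qed

lemma boson_assoc:
  assumes [lin_rules]: "x \<in> carr (tensor R S)" "y \<in> carr (tensor R S)" "z \<in> carr (tensor R S)"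
  shows "boson (boson x y) z = boson x (boson y z)"
proof (rule tensor_lin_unique[OF A.k_space_R k_space_tensor _ _ _ assms(1)])
  fix r s assume 1 [lin_rules]: "r \<in> carr R" "s \<in> carr S"
  show "boson (boson (tens R S r s) y) z = boson (tens R S r s) (boson y z)"
  proof (rule tensor_lin_unique[OF A.k_space_R k_space_tensor _ _ _ assms(2)])
    fix r' s' assume 2 [lin_rules]: "r' \<in> carr R" "s' \<in> carr S"
    show "boson (boson (tens R S r s) (tens R S r' s')) z = boson (tens R S r s) (boson (tens R S r' s') z)"
      by (rule tensor_lin_unique[OF A.k_space_R k_space_tensor _ _ _ assms(3)])
        (assumption | rule boson_assoc_tens 1 2 lin_rules)+
  qed (assumption | rule lin_rules)+
qed (assumption | rule lin_rules)+

lemma boson_left: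
  assumes [lin_rules]: "r \<in> carr R" "r' \<in> carr R" "s' \<in> carr S"
  shows "boson (tens R S r (unity S)) (tens R S r' s') = tens R S (mul R r r') s'"
  by (simp add: boson_tens H.coact_unity sweedler_tens[where Z="tensor R S"] lact_unity lin_rules)

text \<open>Acting on the unit of \<open>R\<close> leaves only the counit of the
  \<open>H\<close>-component of \<open>s\<close>, which the counit law of the coaction
  absorbs.\<close>

lemma boson_right:
  assumes [lin_rules]: "r \<in> carr R" "s \<in> carr S" "s' \<in> carr S"
  shows "boson (tens R S r s) (tens R S (unity R) s') = tens R S r (mul S s s')"
proof -
  have "boson (tens R S r s) (tens R S (unity R) s') =
    tens R S r (mul S (sweedler H S (\<epsilon> s) (\<lambda>x p. smul S (counit H x) p)) s')"
    by (simp add: boson_tens lact_on_unity lin_rules pull_out cong: sweedler_cong)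
  then show ?thesis by (simp add: H.coact_counit lin_rules)
qed

abbreviation boson_alg :: "('k, ('k, 'r, 's) tens) alg" where
  "boson_alg \<equiv> \<lparr>carr = carr (tensor R S), smul = smul (tensor R S), mul = boson,
    unity = tens R S (unity R) (unity S)\<rparr>"

section \<open>Comparison with the smash product\<close>

definition embed :: "('k, 'r, 's) tens \<Rightarrow> ('k, 'a, 'h) tens" where
  "embed z = sweedler R S z (\<lambda>r s. tens A H (i r) (j s))"

lemma lin_embed: "lin (tensor R S) (tensor A H) embed"
  unfolding embed_def by (assumption | rule lin_rules)+

lemmas [lin_rules] = lin_comp[OF lin_embed] lin_mem[OF lin_embed]
lemmas [pull_out] = lin_sweedler_apply[OF _ k_space_tensor k_space_tensor lin_embed] linD(3)[OF lin_embed, unfolded smul_tensor]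

lemma embed_tens:
  assumes [lin_rules]: "r \<in> carr R" "s \<in> carr S"
  shows "embed (tens R S r s) = tens A H (i r) (j s)"
  by (simp add: embed_def sweedler_tens[where Z="tensor A H"] lin_rules)

text \<open>The map P \<otimes> Q, which inverts i \<otimes> j from the left and so gives
  injectivity of \<open>embed\<close>.\<close>

definition unembed :: "('k, 'a, 'h) tens \<Rightarrow> ('k, 'r, 's) tens" where
  "unembed z = sweedler A H z (\<lambda>\<alpha> \<xi>. tens R S (P \<alpha>) (Q \<xi>))"

lemma lin_unembed: "lin (tensor A H) (tensor R S) unembed"
  unfolding unembed_def by (assumption | rule lin_rules)+

lemma unembed_embed:
  assumes "z \<in> carr (tensor R S)"
  shows "unembed (embed z) = z"
proof (rule tensor_lin_unique[OF A.k_space_R k_space_tensor lin_comp[OF lin_unembed lin_embed] lin_ident _ assms])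
  fix r s assume [lin_rules]: "r \<in> carr R" "s \<in> carr S"
  show "unembed (embed (tens R S r s)) = tens R S r s"
    by (simp add: embed_tens unembed_def sweedler_tens[where Z="tensor R S"] A.proj_incl H.proj_incl lin_rules)
qed

text \<open>The smash product takes the coproducts of the inner factors \<open>j s\<close> and
  \<open>i r'\<close>. Being left coideals, \<open>S\<close> and \<open>R\<close> keep the second
  legs in \<open>j S\<close> and \<open>i R\<close>, so the result stays in the image of
  \<open>embed\<close>, and the pairing of the first legs is the action \<open>lact\<close>.\<close>

lemma embed_boson:
  assumes "z \<in> carr (tensor R S)" and "z' \<in> carr (tensor R S)"
  shows "mul (smash A H \<tau>) (embed z) (embed z') = embed (boson z z')"
proof -
  have mul: "bilin (tensor A H) (tensor A H) (tensor A H) (mul (smash A H \<tau>))"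
    unfolding smash_def alg.simps by (assumption | rule lin_rules)+
  note [lin_rules] = assms bilin_comp1[OF mul] bilin_comp2[OF mul]
  show ?thesis
  proof (rule tensor_lin_unique[OF A.k_space_R k_space_tensor _ _ _ assms(1)])
    fix r s assume 1 [lin_rules]: "r \<in> carr R" "s \<in> carr S"
    show "mul (smash A H \<tau>) (embed (tens R S r s)) (embed z') = embed (boson (tens R S r s) z')"
    proof (rule tensor_lin_unique[OF A.k_space_R k_space_tensor _ _ _ assms(2)])
      fix r' s' assume 2 [lin_rules]: "r' \<in> carr R" "s' \<in> carr S"
      have "mul (smash A H \<tau>) (embed (tens R S r s)) (embed (tens R S r' s')) =
        sweedler A R (\<delta> r') (\<lambda>\<alpha> q. sweedler H S (\<epsilon> s) (\<lambda>\<xi> p.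
          tscale (\<tau> \<alpha> \<xi>) (tens A H (mul A (i r) (i q)) (mul H (j p) (j s')))))"
        by (simp add: smash_def embed_tens A.incl_comul H.incl_comul sweedler_tens[where Z="tensor A H"]
            sweedler_sweedler[where Z="tensor A H"] lin_rules cong: sweedler_cong)
      also have "\<dots> = sweedler H S (\<epsilon> s) (\<lambda>\<xi> p. sweedler A R (\<delta> r') (\<lambda>\<alpha> q.
          tscale (\<tau> \<alpha> \<xi>) (tens A H (mul A (i r) (i q)) (mul H (j p) (j s')))))"
        by (rule sweedler_swap[where Z="tensor A H"]) (assumption | rule lin_rules)+
      also have "\<dots> = embed (boson (tens R S r s) (tens R S r' s'))"
        by (simp add: boson_tens lact_def embed_tens A.incl_mul H.incl_mul lin_rules pull_out cong: sweedler_cong)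
      finally show "mul (smash A H \<tau>) (embed (tens R S r s)) (embed (tens R S r' s')) =
        embed (boson (tens R S r s) (tens R S r' s'))" .
    qed (assumption | rule lin_rules)+
  qed (assumption | rule lin_rules)+
qed

end

text \<open>Associativity and unit laws pass along a surjective multiplicative linear map. It serves
  for \<open>RS\<close>, along \<open>embed\<close>, and for the version of the boson product that
  vanishes off the carrier, along the identity.\<close>

lemma algebra_image:
  assumes X: "algebra X" and Y: "k_space Y" and f: "lin X Y f" and surj: "carr Y = f ` carr X"
    and unity: "unity Y = f (unity X)"
    and mul: "\<And>x y. x \<in> carr X \<Longrightarrow> y \<in> carr X \<Longrightarrow> mul Y (f x) (f y) = f (mul X x y)"
  shows "algebra Y"
proof -
  have bX: "bilin X X X (mul X)" and uX: "unity X \<in> carr X"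
    and aX: "x \<in> carr X \<Longrightarrow> y \<in> carr X \<Longrightarrow> z \<in> carr X \<Longrightarrow> mul X (mul X x y) z = mul X x (mul X y z)"
    and iX: "x \<in> carr X \<Longrightarrow> mul X (unity X) x = x" "x \<in> carr X \<Longrightarrow> mul X x (unity X) = x"
    and kX: "k_space X" for x y z
    using X by (simp_all add: algebra_def)
  note m = bilin_mem[OF bX] and k = k_spaceD[OF kX]
  have 1: "lin Y Y (\<lambda>y. mul Y (f x) y)" "lin Y Y (\<lambda>y. mul Y y (f x))" if "x \<in> carr X" for x
    unfolding lin_def surj ball_simps
    using that linD(2,3)[OF bilinD(1)[OF bX]] linD(2,3)[OF bilinD(2)[OF bX]]
    by (auto simp: mul m k linD(2,3)[OF f, symmetric])
  have "bilin Y Y Y (mul Y)"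
    using 1 by (auto simp: bilin_def surj)
  then show ?thesis
    using uX by (auto simp: algebra_def Y surj unity mul m aX iX)
qed

context coideal_pair
begin

lemma algebra_boson_alg: "algebra boson_alg"
proof -
  have "bilin boson_alg boson_alg boson_alg boson"
    using bilin_boson by (simp add: bilin_def lin_def)
  moreover have "k_space boson_alg"
    using k_space_tensor[of R S] by (simp add: k_space_def)
  moreover have "boson (tens R S (unity R) (unity S)) z = z" if "z \<in> carr (tensor R S)" for z
  proof (rule tensor_lin_unique[OF A.k_space_R k_space_tensor _ lin_ident _ that])
    show "lin (tensor R S) (tensor R S) (boson (tens R S (unity R) (unity S)))"
      by (assumption | rule lin_rules)+
  qed (simp add: boson_left lin_rules)
  moreover have "boson z (tens R S (unity R) (unity S)) = z" if "z \<in> carr (tensor R S)" for z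
  proof (rule tensor_lin_unique[OF A.k_space_R k_space_tensor _ lin_ident _ that])
    show "lin (tensor R S) (tensor R S) (\<lambda>z. boson z (tens R S (unity R) (unity S)))"
      by (assumption | rule lin_rules)+
  qed (simp add: boson_right lin_rules)
  ultimately show ?thesis
    by (simp add: algebra_def boson_assoc lin_rules)
qed

definition RS :: "('k, ('k, 'a, 'h) tens) alg" where
  "RS = (smash A H \<tau>)\<lparr>carr := tspan A H (i ` carr R) (j ` carr S)\<rparr>"

lemma carr_RS: "carr RS = embed ` carr (tensor R S)"
proof -
  interpret t: vector_space "tscale :: 'k \<Rightarrow> ('k, 'a, 'h) tens \<Rightarrow> _" by (rule vector_space_tscale)
  let ?G = "{tens A H x y |x y. x \<in> i ` carr R \<and> y \<in> j ` carr S}"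
  have zero: "embed 0 = 0"
    by (rule lin_zero[OF k_space_tensor k_space_tensor lin_embed])
  \<comment> \<open>The image is a subspace containing the spanning tensors, hence it contains their
    span; the converse inclusion is an induction over the span in R \<otimes> S.\<close>
  have "t.subspace (embed ` carr (tensor R S))"
  proof (rule t.subspaceI)
    show "0 \<in> embed ` carr (tensor R S)"
      using zero by (intro image_eqI[where x = 0] k_spaceD(1)[OF k_space_tensor]) simp
    show "x + y \<in> embed ` carr (tensor R S)"
      if "x \<in> embed ` carr (tensor R S)" "y \<in> embed ` carr (tensor R S)" for x y
      using that by (auto simp: linD(2)[OF lin_embed, symmetric] intro!: imageI k_spaceD(2)[OF k_space_tensor])
    show "tscale c x \<in> embed ` carr (tensor R S)" if "x \<in> embed ` carr (tensor R S)" for c x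
      using that by (auto simp: linD(3)[OF lin_embed, unfolded smul_tensor, symmetric] intro!: imageI tscale_mem)
  qed
  moreover have "?G \<subseteq> embed ` carr (tensor R S)"
    by (auto simp: embed_tens[symmetric] intro!: imageI tens_mem)
  ultimately have "t.span ?G \<subseteq> embed ` carr (tensor R S)"
    by (rule t.span_minimal[rotated])
  moreover have "embed z \<in> t.span ?G" if "z \<in> carr (tensor R S)" for z
  proof -
    interpret u: vector_space "tscale :: 'k \<Rightarrow> ('k, 'r, 's) tens \<Rightarrow> _" by (rule vector_space_tscale)
    have "z \<in> u.span {tens R S x y |x y. x \<in> carr R \<and> y \<in> carr S}"
      using that by (simp add: tensor_def tspan_def)
    \<comment> \<open>Membership of \<open>z\<close> is carried through the induction because
      \<open>embed\<close> is known to be additive only on the carrier.\<close>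
    then have "z \<in> carr (tensor R S) \<and> embed z \<in> t.span ?G"
    proof (induction rule: u.span_induct_alt)
      case base
      show ?case unfolding zero by (intro conjI t.span_zero k_spaceD(1)[OF k_space_tensor])
    next
      case (step c x y)
      then obtain r s where rs: "r \<in> carr R" "s \<in> carr S" "x = tens R S r s" by blast
      then have x: "x \<in> carr (tensor R S)" "embed x \<in> t.span ?G"
        by (auto simp: tens_mem embed_tens intro!: t.span_base)
      with step have y: "y \<in> carr (tensor R S)" "embed y \<in> t.span ?G" by auto
      have *: "embed (tscale c x + y) = tscale c (embed x) + embed y"
        by (simp add: linD(2)[OF lin_embed] linD(3)[OF lin_embed, unfolded smul_tensor] x y tscale_mem)
      show ?case unfolding *
        by (intro conjI t.span_add t.span_scale k_spaceD(2)[OF k_space_tensor] tscale_mem x y)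
    qed
    then show ?thesis ..
  qed
  ultimately show ?thesis
    by (auto simp: RS_def tspan_def)
qed

lemma RS_simps: "mul RS = mul (smash A H \<tau>)" "smul RS = tscale" "unity RS = tens A H (unity A) (unity H)"
  by (simp_all add: RS_def smash_def tensor_def)

lemma k_space_RS: "k_space RS"
proof -
  interpret t: vector_space "tscale :: 'k \<Rightarrow> ('k, 'a, 'h) tens \<Rightarrow> _" by (rule vector_space_tscale)
  show ?thesis
    by (simp add: k_space_def RS_simps vector_space_tscale) (simp add: RS_def tspan_def t.subspace_span)
qed

lemma unity_RS: "unity RS = embed (tens R S (unity R) (unity S))"
  by (simp add: RS_simps embed_tens lin_rules A.incl_unity H.incl_unity)

lemma algebra_RS: "algebra RS"
proof (rule algebra_image[OF algebra_boson_alg k_space_RS])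
  show "lin boson_alg RS embed"
    using lin_embed by (simp add: lin_def carr_RS RS_simps smul_tensor)
qed (simp_all add: carr_RS unity_RS, simp add: RS_simps embed_boson)

section \<open>The representation on R\<close>

text \<open>Elements of R # S leave \<open>i R\<close> invariant: the action of \<open>H\<close>
  preserves it by \<open>incl_lact\<close>, and left multiplication by \<open>i r\<close> preserves
  it because \<open>i\<close> is multiplicative.\<close>

lemma smash_rep_embed:
  assumes "z \<in> carr (tensor R S)" and [lin_rules]: "r' \<in> carr R"
  shows "smash_rep A H \<tau> (embed z) (i r') = i (sweedler R S z (\<lambda>r s. mul R r (lact (j s) r')))"
proof (rule tensor_lin_unique[OF A.k_space_R A.k_space_A _ _ _ assms(1)])
  show "lin (tensor R S) A (\<lambda>z. smash_rep A H \<tau> (embed z) (i r'))"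
    unfolding smash_rep_def hact_def by (assumption | rule lin_rules)+
  show "lin (tensor R S) A (\<lambda>z. i (sweedler R S z (\<lambda>r s. mul R r (lact (j s) r'))))"
    by (assumption | rule lin_rules)+
  fix r s assume 1 [lin_rules]: "r \<in> carr R" "s \<in> carr S"
  have b: "bilin A H A (\<lambda>\<alpha> \<xi>. mul A \<alpha> (hact A \<tau> \<xi> (i r')))"
    unfolding hact_def by (assumption | rule lin_rules)+
  show "smash_rep A H \<tau> (embed (tens R S r s)) (i r') = i (sweedler R S (tens R S r s) (\<lambda>r s. mul R r (lact (j s) r')))"
    by (simp add: smash_rep_def embed_tens sweedler_tens[OF A.k_space_A b] sweedler_tens[where Z=R] A.incl_mul incl_lact lin_rules)
qed

text \<open>Applying \<open>P\<close> gives a map into \<open>R\<close> that is bilinear by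
  composition on all of A \<otimes> H. On \<open>RS\<close> the value of \<open>smash_rep\<close>
  already lies in \<open>i R\<close>, and \<open>P\<close> merely undoes \<open>i\<close>; see
  \<open>incl_rep\<close>.\<close>

definition rep :: "('k, 'a, 'h) tens \<Rightarrow> 'r \<Rightarrow> 'r" where
  "rep z r = P (smash_rep A H \<tau> z (i r))"

lemma bilin_rep: "bilin RS R R rep"
proof -
  have "bilin (tensor A H) R R rep"
    unfolding rep_def smash_rep_def hact_def by (assumption | rule lin_rules)+
  then show ?thesis
    by (auto simp: bilin_def lin_def carr_RS RS_simps smul_tensor linD(1)[OF lin_embed])
qed

lemma rep_embed:
  assumes [lin_rules]: "z \<in> carr (tensor R S)" "r' \<in> carr R"
  shows "rep (embed z) r' = sweedler R S z (\<lambda>r s. mul R r (lact (j s) r'))"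
  by (simp add: rep_def smash_rep_embed A.proj_incl lin_rules)

lemma rep_tens:
  assumes [lin_rules]: "r \<in> carr R" "s \<in> carr S" "r' \<in> carr R"
  shows "rep (embed (tens R S r s)) r' = mul R r (lact (j s) r')"
  by (simp add: rep_embed sweedler_tens[where Z=R] lin_rules)

lemma incl_rep: "z \<in> carr RS \<Longrightarrow> r \<in> carr R \<Longrightarrow> i (rep z r) = smash_rep A H \<tau> z (i r)"
  by (auto simp: carr_RS rep_embed smash_rep_embed)

text \<open>In the product, \<open>s\<close> coacts to x \<otimes> p, with \<open>x\<close> acting
  on \<open>r'\<close> and \<open>j p\<close> on the remaining factor. Letting \<open>j s\<close>
  act on a product in \<open>R\<close> splits it in the same way, by
  \<open>H.incl_comul\<close>.\<close>

lemma rep_boson_tens: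
  assumes [lin_rules]: "r \<in> carr R" "s \<in> carr S" "r' \<in> carr R" "s' \<in> carr S" "q \<in> carr R"
  shows "rep (embed (boson (tens R S r s) (tens R S r' s'))) q = mul R r (lact (j s) (mul R r' (lact (j s') q)))"
proof -
  have "rep (embed (boson (tens R S r s) (tens R S r' s'))) q =
      sweedler H S (\<epsilon> s) (\<lambda>x p. mul R (mul R r (lact x r')) (lact (mul H (j p) (j s')) q))"
    by (simp add: rep_embed boson_tens sweedler_sweedler[where Z=R] sweedler_tens[where Z=R] H.incl_mul lin_rules cong: sweedler_cong)
  also have "\<dots> = mul R r (lact (j s) (mul R r' (lact (j s') q)))"
    by (simp add: lact_on_mul H.incl_comul A.mul_assoc sweedler_sweedler[where Z=R] sweedler_tens[where Z=R] lact_mul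
        lin_rules pull_out cong: sweedler_cong)
  finally show ?thesis .
qed

lemma rep_boson:
  assumes z: "z \<in> carr (tensor R S)" and z': "z' \<in> carr (tensor R S)" and [lin_rules]: "q \<in> carr R"
  shows "rep (embed (boson z z')) q = rep (embed z) (rep (embed z') q)"
proof -
  have e: "lin (tensor R S) RS embed"
    using lin_embed by (simp add: lin_def carr_RS RS_simps smul_tensor)
  note [lin_rules] = bilin_comp1[OF bilin_rep] bilin_comp2[OF bilin_rep] bilin_mem[OF bilin_rep]
    lin_comp[OF e] lin_mem[OF e] z z'
  show ?thesis
  proof (rule tensor_lin_unique[OF A.k_space_R A.k_space_R _ _ _ z])
    fix r s assume 1 [lin_rules]: "r \<in> carr R" "s \<in> carr S"
    show "rep (embed (boson (tens R S r s) z')) q = rep (embed (tens R S r s)) (rep (embed z') q)"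
    proof (rule tensor_lin_unique[OF A.k_space_R A.k_space_R _ _ _ z'])
      fix r' s' assume 2 [lin_rules]: "r' \<in> carr R" "s' \<in> carr S"
      show "rep (embed (boson (tens R S r s) (tens R S r' s'))) q = rep (embed (tens R S r s)) (rep (embed (tens R S r' s')) q)"
        by (simp add: rep_boson_tens rep_tens lin_rules)
    qed (assumption | rule lin_rules)+
  qed (assumption | rule lin_rules)+
qed

lemma alg_rep_rep: "alg_rep RS R rep"
  unfolding alg_rep_def
proof (intro conjI ballI)
  have uj: "j (unity S) = unity H" by (rule H.incl_unity)
  show "rep (unity RS) r = r" if "r \<in> carr R" for r
    using that by (simp add: unity_RS rep_tens uj lact_unity lin_rules)
  show "rep (mul RS a b) r = rep a (rep b r)" if "a \<in> carr RS" "b \<in> carr RS" "r \<in> carr R" for a b r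
    using that by (auto simp: carr_RS RS_simps embed_boson rep_boson)
qed (rule algebra_RS A.k_space_R bilin_rep)+

end

section \<open>The bosonization\<close>

lemma bosonization_space:
  "carr (bosonization R J) = carr (tensor R J)" "smul (bosonization R J) = tscale"
  by (simp_all add: bosonization_def tensor_def)

lemma lin_bosonization:
  "lin (bosonization R J) Y = lin (tensor R J) Y" "lin X (bosonization R J) = lin X (tensor R J)"
  by (auto simp: fun_eq_iff lin_def bosonization_space smul_tensor)

lemma bilin_bosonization:
  "bilin (bosonization R J) Y Z = bilin (tensor R J) Y Z"
  "bilin X (bosonization R J) Z = bilin X (tensor R J) Z"
  "bilin X Y (bosonization R J) = bilin X Y (tensor R J)"
  by (auto simp: fun_eq_iff bilin_def lin_bosonization bosonization_space)

text \<open>Tensors and Sweedler sums read only the carriers and scalars of their spaces, and these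
  are the same for the bosonization as for R \<otimes> J. Rules about \<open>tensor R J\<close>
  thereby apply to the bosonization.\<close>

lemma tensor_bosonization:
  "tens (bosonization R J) Y = tens (tensor R J) Y" "tens X (bosonization R J) = tens X (tensor R J)"
  "tensor (bosonization R J) Y = tensor (tensor R J) Y" "tensor X (bosonization R J) = tensor X (tensor R J)"
  "sweedler (bosonization R J) Y = sweedler (tensor R J) Y" "sweedler X (bosonization R J) = sweedler X (tensor R J)"
proof -
  show 1: "tens (bosonization R J) Y = tens (tensor R J) Y" and 2: "tens X (bosonization R J) = tens X (tensor R J)"
    by (auto simp: fun_eq_iff tens_def bilin_bosonization)
  show "tensor (bosonization R J) Y = tensor (tensor R J) Y" "tensor X (bosonization R J) = tensor X (tensor R J)"
    by (simp_all add: tensor_def[of "bosonization R J"] tensor_def[of X "bosonization R J"] tspan_def 1 2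
        bosonization_space) (simp_all add: tensor_def tspan_def)
  show "sweedler (bosonization R J) Y = sweedler (tensor R J) Y" "sweedler X (bosonization R J) = sweedler X (tensor R J)"
    unfolding sweedler_def 1 2 bosonization_space by (rule refl)+
qed

lemma k_space_bosonization: "k_space (bosonization R J)"
  using k_space_tensor[of R J] by (simp add: k_space_def bosonization_space smul_tensor)

lemmas bosonization_simps = bosonization_space lin_bosonization bilin_bosonization tensor_bosonization

section \<open>Structure maps of a braided bialgebra\<close>

locale braided =
  fixes J :: "('k::field, 'j::ab_group_add, 'm) hopf_scheme"
    and R :: "('k, 'r::ab_group_add, 'j, 'n) yd_bialg_scheme"
  assumes hopf: "hopf_algebra J" and braided: "braided_bialgebra J R"
begin

lemma
  shows k_space_J: "k_space J" and bilin_mul_J: "bilin J J J (mul J)" and unity_J: "unity J \<in> carr J"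
    and mul_unity_J: "\<And>a. a \<in> carr J \<Longrightarrow> mul J (unity J) a = a" "\<And>a. a \<in> carr J \<Longrightarrow> mul J a (unity J) = a"
    and lin_comul_J: "lin J (tensor J J) (comul J)" and lin_counit_J: "lin J ground (counit J)"
    and comul_unity_J: "comul J (unity J) = tens J J (unity J) (unity J)"
    and counit_unity_J: "counit J (unity J) = 1"
  using hopf unfolding hopf_algebra_def bialgebra_def algebra_def coalgebra_def by - (elim conjE; blast)+

lemma
  shows yd_R: "yd_module J R (ract R) (rcoact R)" and algebra_R: "algebra R" and coalgebra_R: "coalgebra R"
    and comul_unity_R: "comul R (unity R) = tens R R (unity R) (unity R)"
    and counit_unity_R: "counit R (unity R) = 1"
    and comul_mul_R [rule_format]: "\<forall>r\<in>carr R. \<forall>s\<in>carr R. comul R (mul R r s) =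
        sweedler R R (comul R r) (\<lambda>r1 r2. sweedler R R (comul R s) (\<lambda>s1 s2.
          sweedler J R (rcoact R r2) (\<lambda>h r2'.
            tens R R (mul R r1 (ract R h s1)) (mul R r2' s2))))"
    and coact_unity: "rcoact R (unity R) = tens J R (unity J) (unity R)"
    and coact_mul [rule_format]: "\<forall>r\<in>carr R. \<forall>s\<in>carr R. rcoact R (mul R r s) =
        sweedler J R (rcoact R r) (\<lambda>h r'. sweedler J R (rcoact R s) (\<lambda>h' s'.
          tens J R (mul J h h') (mul R r' s')))"
    and coact_comul [rule_format]: "\<forall>r\<in>carr R.
      sweedler J R (rcoact R r) (\<lambda>h r'. tens J (tensor R R) h (comul R r')) =
      sweedler R R (comul R r) (\<lambda>r1 r2.
        sweedler J R (rcoact R r1) (\<lambda>h1 r1'. sweedler J R (rcoact R r2) (\<lambda>h2 r2'.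
          tens J (tensor R R) (mul J h1 h2) (tens R R r1' r2'))))"
  using braided unfolding braided_bialgebra_def by - (elim conjE; assumption)+

lemma
  shows k_space_R: "k_space R" and bilin_mul_R: "bilin R R R (mul R)" and unity_R: "unity R \<in> carr R"
  using algebra_R unfolding algebra_def by blast+

lemma
  shows lin_comul_R: "lin R (tensor R R) (comul R)" and lin_counit_R: "lin R ground (counit R)"
    and comul_counit1_R: "\<And>c. c \<in> carr R \<Longrightarrow> sweedler R R (comul R c) (\<lambda>c1 c2. smul R (counit R c1) c2) = c"
    and comul_counit2_R: "\<And>c. c \<in> carr R \<Longrightarrow> sweedler R R (comul R c) (\<lambda>c1 c2. smul R (counit R c2) c1) = c"
    and comul_coassoc_R: "\<And>c. c \<in> carr R \<Longrightarrow> sweedler R R (comul R c) (\<lambda>c1 c2. tens R (tensor R R) c1 (comul R c2)) =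
      sweedler R R (comul R c) (\<lambda>c1 c2. sweedler R R (comul R c1) (\<lambda>c11 c12.
        tens R (tensor R R) c11 (tens R R c12 c2)))"
  using coalgebra_R unfolding coalgebra_def by blast+

lemma
  shows bilin_act: "bilin J R R (ract R)" and act_unity: "\<And>r. r \<in> carr R \<Longrightarrow> ract R (unity J) r = r"
    and lin_coact: "lin R (tensor J R) (rcoact R)"
    and coact_counit: "\<And>x. x \<in> carr R \<Longrightarrow> sweedler J R (rcoact R x) (\<lambda>h y. smul R (counit J h) y) = x"
    and coact_coassoc: "\<And>x. x \<in> carr R \<Longrightarrow> sweedler J R (rcoact R x) (\<lambda>h y. tens J (tensor J R) h (rcoact R y)) =
      sweedler J R (rcoact R x) (\<lambda>h y. sweedler J J (comul J h) (\<lambda>h1 h2.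
        tens J (tensor J R) h1 (tens J R h2 y)))"
  using yd_R unfolding yd_module_def alg_rep_def by blast+

lemmas [lin_rules] = k_space_J k_space_R unity_J unity_R k_space_bosonization
  bilin_comp1[OF bilin_mul_J] bilin_comp2[OF bilin_mul_J] bilin_mem[OF bilin_mul_J]
  bilin_comp1[OF bilin_mul_R] bilin_comp2[OF bilin_mul_R] bilin_mem[OF bilin_mul_R]
  bilin_comp1[OF bilin_act] bilin_comp2[OF bilin_act] bilin_mem[OF bilin_act]
  lin_comp[OF lin_comul_J] lin_mem[OF lin_comul_J] lin_comp[OF lin_counit_J]
  lin_comp[OF lin_comul_R] lin_mem[OF lin_comul_R] lin_comp[OF lin_counit_R]
  lin_comp[OF lin_coact] lin_mem[OF lin_coact]

lemmas [pull_out] = bilin_sweedler1[OF bilin_mul_J k_space_J k_space_J] bilin_sweedler2[OF bilin_mul_J k_space_J k_space_J]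
  bilin_sweedler1[OF bilin_mul_R k_space_R k_space_R] bilin_sweedler2[OF bilin_mul_R k_space_R k_space_R]
  bilin_sweedler1[OF bilin_act k_space_J k_space_R] bilin_sweedler2[OF bilin_act k_space_R k_space_R]
  bilin_scale[OF bilin_mul_J] bilin_scale[OF bilin_mul_R] bilin_scale[OF bilin_act]
  lin_sweedler_apply[OF _ k_space_R k_space_tensor lin_coact] linD(3)[OF lin_coact, unfolded smul_tensor]
  lin_sweedler_apply[OF _ k_space_R k_space_tensor lin_comul_R] linD(3)[OF lin_comul_R, unfolded smul_tensor]
  lin_sweedler_apply[OF _ k_space_J k_space_tensor lin_comul_J] linD(3)[OF lin_comul_J, unfolded smul_tensor]

lemmas comul_coassoc = coassoc_test[OF k_space_R k_space_R k_space_R _ lin_mem[OF lin_comul_R] lin_comul_R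
    lin_comul_R comul_coassoc_R]

lemmas coassoc = coassoc_test[OF k_space_J k_space_J k_space_R _ lin_mem[OF lin_coact] lin_coact
    lin_comul_J coact_coassoc]

text \<open>The coproduct of \<open>R\<close> is a comodule map for the diagonal coaction on R
  \<otimes> R; this is that law tested against trilinear maps, in the manner of
  \<open>coassoc_test\<close>.\<close>

lemma coact_comul_test:
  assumes Z [lin_rules]: "k_space Z" and T: "trilin J R R Z T" and r [lin_rules]: "r \<in> carr R"
  shows "sweedler J R (rcoact R r) (\<lambda>h p. sweedler R R (comul R p) (\<lambda>p1 p2. T h p1 p2)) =
    sweedler R R (comul R r) (\<lambda>r1 r2. sweedler J R (rcoact R r1) (\<lambda>h1 r1'.
      sweedler J R (rcoact R r2) (\<lambda>h2 r2'. T (mul J h1 h2) r1' r2')))"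
proof -
  note [lin_rules] = trilin_comp[OF T]
  define E where "E u = sweedler J (tensor R R) u (\<lambda>h v. sweedler R R v (\<lambda>p1 p2. T h p1 p2))" for u
  show ?thesis
    using arg_cong[where f=E, OF coact_comul[OF r]]
    by (simp add: E_def sweedler_sweedler[where Z=Z] sweedler_tens[where Z=Z] lin_rules cong: sweedler_cong)
qed

section \<open>The operations of the bosonization on pure tensors\<close>

abbreviation A :: "('k, ('k, 'r, 'j) tens) bialg" where
  "A \<equiv> bosonization R J"

lemma bilin_mul_A: "bilin (tensor R J) (tensor R J) (tensor R J) (mul A)"
  unfolding bosonization_def alg.simps by (assumption | rule lin_rules)+

lemma lin_comul_A: "lin (tensor R J) (tensor (tensor R J) (tensor R J)) (comul A)"
  unfolding bosonization_def bialg.simps by (assumption | rule lin_rules)+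

lemma lin_counit_A: "lin (tensor R J) ground (counit A)"
  unfolding bosonization_def bialg.simps by (assumption | rule lin_rules)+

lemmas [lin_rules] = bilin_comp1[OF bilin_mul_A] bilin_comp2[OF bilin_mul_A] bilin_mem[OF bilin_mul_A]
  lin_comp[OF lin_comul_A] lin_mem[OF lin_comul_A] lin_comp[OF lin_counit_A]

lemma mul_A:
  assumes [lin_rules]: "r \<in> carr R" "a \<in> carr J" "s \<in> carr R" "b \<in> carr J"
  shows "mul A (tens R J r a) (tens R J s b) =
    sweedler J J (comul J a) (\<lambda>a1 a2. tens R J (mul R r (ract R a1 s)) (mul J a2 b))"
  by (simp add: bosonization_def sweedler_tens[where Z="tensor R J"] lin_rules)

lemma comul_A:
  assumes [lin_rules]: "r \<in> carr R" "a \<in> carr J"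
  shows "comul A (tens R J r a) = sweedler R R (comul R r) (\<lambda>r1 r2. sweedler J R (rcoact R r2) (\<lambda>h r2'.
    sweedler J J (comul J a) (\<lambda>a1 a2.
      tens (tensor R J) (tensor R J) (tens R J r1 (mul J h a1)) (tens R J r2' a2))))"
  by (simp add: bosonization_def sweedler_tens[where Z="tensor (tensor R J) (tensor R J)"] lin_rules)

lemma counit_A:
  assumes [lin_rules]: "r \<in> carr R" "a \<in> carr J"
  shows "counit A (tens R J r a) = counit R r * counit J a"
  by (simp add: bosonization_def sweedler_tens[where Z=ground] lin_rules)

lemma unity_A: "unity A = tens R J (unity R) (unity J)"
  by (simp add: bosonization_def)

section \<open>R as a left coideal subalgebra of its bosonization\<close>

definition bcoact :: "'r \<Rightarrow> ('k, ('k, 'r, 'j) tens, 'r) tens" where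
  "bcoact r = sweedler R R (comul R r) (\<lambda>r1 r2. sweedler J R (rcoact R r2) (\<lambda>h p.
    tens (tensor R J) R (tens R J r1 h) p))"

lemma lin_bcoact: "lin R (tensor (tensor R J) R) bcoact"
  unfolding bcoact_def by (assumption | rule lin_rules)+

lemmas [lin_rules] = lin_comp[OF lin_bcoact] lin_mem[OF lin_bcoact]

text \<open>The braiding in the coproduct of \<open>R\<close> matches the cross relation of
  \<open>J\<close> with \<open>R\<close> in \<open>A\<close>. After expansion the second leg of
  \<open>r\<close> has coacted twice, once acting on \<open>s1\<close> and once multiplying;
  \<open>mul_A\<close> splits one component by the coproduct of \<open>J\<close> for the same two
  purposes.\<close>

lemma bcoact_mul:
  assumes [lin_rules]: "r \<in> carr R" "s \<in> carr R"
  shows "bcoact (mul R r s) = sweedler (tensor R J) R (bcoact r) (\<lambda>\<alpha> p. sweedler (tensor R J) R (bcoact s) (\<lambda>\<beta> q.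
    tens (tensor R J) R (mul A \<alpha> \<beta>) (mul R p q)))" (is "_ = ?rhs")
proof -
  let ?Z = "tensor (tensor R J) R"
  have "bcoact (mul R r s) = sweedler R R (comul R r) (\<lambda>r1 r2. sweedler R R (comul R s) (\<lambda>s1 s2.
     sweedler J R (rcoact R r2) (\<lambda>h q. sweedler J R (rcoact R q) (\<lambda>h' q'. sweedler J R (rcoact R s2) (\<lambda>g p.
       tens (tensor R J) R (tens R J (mul R r1 (ract R h s1)) (mul J h' g)) (mul R q' p))))))"
    by (simp add: bcoact_def comul_mul_R coact_mul sweedler_sweedler[where Z="?Z"] sweedler_tens[where Z="?Z"]
        lin_rules cong: sweedler_cong)
  also have "\<dots> = sweedler R R (comul R r) (\<lambda>r1 r2. sweedler J R (rcoact R r2) (\<lambda>h q. sweedler R R (comul R s) (\<lambda>s1 s2.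
     sweedler J R (rcoact R q) (\<lambda>h' q'. sweedler J R (rcoact R s2) (\<lambda>g p.
       tens (tensor R J) R (tens R J (mul R r1 (ract R h s1)) (mul J h' g)) (mul R q' p))))))"
    by (intro sweedler_cong refl sweedler_swap[where Z="?Z"]) (assumption | rule lin_rules)+
  also have "\<dots> = sweedler R R (comul R r) (\<lambda>r1 r2. sweedler J R (rcoact R r2) (\<lambda>h q. sweedler J R (rcoact R q) (\<lambda>h' q'.
     sweedler R R (comul R s) (\<lambda>s1 s2. sweedler J R (rcoact R s2) (\<lambda>g p.
       tens (tensor R J) R (tens R J (mul R r1 (ract R h s1)) (mul J h' g)) (mul R q' p))))))"
    by (intro sweedler_cong refl sweedler_swap[where Z="?Z"]) (assumption | rule lin_rules)+
  \<comment> \<open>Coassociativity of the coaction replaces the second coaction by a coproduct in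
    \<open>J\<close>. All other steps only reorder sums.\<close>
  also have "\<dots> = sweedler R R (comul R r) (\<lambda>r1 r2. sweedler J R (rcoact R r2) (\<lambda>h q. sweedler J J (comul J h) (\<lambda>h1 h2.
     sweedler R R (comul R s) (\<lambda>s1 s2. sweedler J R (rcoact R s2) (\<lambda>g p.
       tens (tensor R J) R (tens R J (mul R r1 (ract R h1 s1)) (mul J h2 g)) (mul R q p))))))"
    by (intro sweedler_cong refl coassoc[where Z="?Z"]) (assumption | rule lin_rules)+
  also have "\<dots> = sweedler R R (comul R r) (\<lambda>r1 r2. sweedler J R (rcoact R r2) (\<lambda>h q. sweedler R R (comul R s) (\<lambda>s1 s2.
     sweedler J J (comul J h) (\<lambda>h1 h2. sweedler J R (rcoact R s2) (\<lambda>g p.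
       tens (tensor R J) R (tens R J (mul R r1 (ract R h1 s1)) (mul J h2 g)) (mul R q p))))))"
    by (intro sweedler_cong refl sweedler_swap[where Z="?Z"]) (assumption | rule lin_rules)+
  also have "\<dots> = sweedler R R (comul R r) (\<lambda>r1 r2. sweedler J R (rcoact R r2) (\<lambda>h q. sweedler R R (comul R s) (\<lambda>s1 s2.
     sweedler J R (rcoact R s2) (\<lambda>g p. sweedler J J (comul J h) (\<lambda>h1 h2.
       tens (tensor R J) R (tens R J (mul R r1 (ract R h1 s1)) (mul J h2 g)) (mul R q p))))))"
    by (intro sweedler_cong refl sweedler_swap[where Z="?Z"]) (assumption | rule lin_rules)+
  also have "\<dots> = ?rhs"
    by (simp add: bcoact_def mul_A sweedler_sweedler[where Z="?Z"] sweedler_tens[where Z="?Z"]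
        lin_rules pull_out cong: sweedler_cong)
  finally show ?thesis .
qed

text \<open>Three laws combine: the coproduct of \<open>R\<close> is a comodule map, the coaction is
  coassociative, and the coproduct of \<open>R\<close> is coassociative. They are applied in this
  order, and the sums are then arranged as \<open>comul_A\<close> produces them.\<close>

lemma bcoact_coassoc:
  assumes [lin_rules]: "r \<in> carr R"
  shows "sweedler (tensor R J) R (bcoact r) (\<lambda>\<alpha> p. tens (tensor R J) (tensor (tensor R J) R) \<alpha> (bcoact p)) =
    sweedler (tensor R J) R (bcoact r) (\<lambda>\<alpha> p. sweedler (tensor R J) (tensor R J) (comul A \<alpha>) (\<lambda>\<alpha>1 \<alpha>2.
      tens (tensor R J) (tensor (tensor R J) R) \<alpha>1 (tens (tensor R J) R \<alpha>2 p)))" (is "?lhs = ?rhs")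
proof -
  let ?T = "tensor R J" and ?Z = "tensor (tensor R J) (tensor (tensor R J) R)"
  have "?lhs = sweedler R R (comul R r) (\<lambda>r1 r2. sweedler J R (rcoact R r2) (\<lambda>h p. sweedler R R (comul R p) (\<lambda>p1 p2.
      sweedler J R (rcoact R p2) (\<lambda>g q. tens ?T (tensor ?T R) (tens R J r1 h) (tens ?T R (tens R J p1 g) q)))))"
    by (simp add: bcoact_def sweedler_sweedler[where Z="?Z"] sweedler_tens[where Z="?Z"] lin_rules pull_out
        cong: sweedler_cong)
  also have "\<dots> = sweedler R R (comul R r) (\<lambda>r1 r2. sweedler R R (comul R r2) (\<lambda>x y. sweedler J R (rcoact R x) (\<lambda>h1 x'.
      sweedler J R (rcoact R y) (\<lambda>h2 y'. sweedler J R (rcoact R y') (\<lambda>g q.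
        tens ?T (tensor ?T R) (tens R J r1 (mul J h1 h2)) (tens ?T R (tens R J x' g) q))))))"
    by (intro sweedler_cong refl coact_comul_test[where Z="?Z"]) (assumption | rule lin_rules)+
  also have "\<dots> = sweedler R R (comul R r) (\<lambda>r1 r2. sweedler R R (comul R r2) (\<lambda>x y. sweedler J R (rcoact R x) (\<lambda>h1 x'.
      sweedler J R (rcoact R y) (\<lambda>h q. sweedler J J (comul J h) (\<lambda>h2 g.
        tens ?T (tensor ?T R) (tens R J r1 (mul J h1 h2)) (tens ?T R (tens R J x' g) q))))))"
    by (intro sweedler_cong refl coassoc[where Z="?Z"]) (assumption | rule lin_rules)+
  also have "\<dots> = sweedler R R (comul R r) (\<lambda>r1 y. sweedler R R (comul R r1) (\<lambda>r1 x. sweedler J R (rcoact R x) (\<lambda>h1 x'.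
      sweedler J R (rcoact R y) (\<lambda>h q. sweedler J J (comul J h) (\<lambda>h2 g.
        tens ?T (tensor ?T R) (tens R J r1 (mul J h1 h2)) (tens ?T R (tens R J x' g) q))))))"
    by (rule comul_coassoc[where Z="?Z"]) (assumption | rule lin_rules)+
  also have "\<dots> = sweedler R R (comul R r) (\<lambda>r1 y. sweedler R R (comul R r1) (\<lambda>r1 x. sweedler J R (rcoact R y) (\<lambda>h q.
      sweedler J R (rcoact R x) (\<lambda>h1 x'. sweedler J J (comul J h) (\<lambda>h2 g.
        tens ?T (tensor ?T R) (tens R J r1 (mul J h1 h2)) (tens ?T R (tens R J x' g) q))))))"
    by (intro sweedler_cong refl sweedler_swap[where Z="?Z"]) (assumption | rule lin_rules)+
  also have "\<dots> = sweedler R R (comul R r) (\<lambda>r1 y. sweedler J R (rcoact R y) (\<lambda>h q. sweedler R R (comul R r1) (\<lambda>r1 x.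
      sweedler J R (rcoact R x) (\<lambda>h1 x'. sweedler J J (comul J h) (\<lambda>h2 g.
        tens ?T (tensor ?T R) (tens R J r1 (mul J h1 h2)) (tens ?T R (tens R J x' g) q))))))"
    by (intro sweedler_cong refl sweedler_swap[where Z="?Z"]) (assumption | rule lin_rules)+
  also have "\<dots> = ?rhs"
    by (simp add: bcoact_def comul_A sweedler_sweedler[where Z="?Z"] sweedler_tens[where Z="?Z"]
        lin_rules pull_out cong: sweedler_cong)
  finally show ?thesis .
qed

lemma bcoact_counit:
  assumes [lin_rules]: "r \<in> carr R"
  shows "sweedler (tensor R J) R (bcoact r) (\<lambda>\<alpha> p. smul R (counit A \<alpha>) p) = r"
proof -
  have "sweedler (tensor R J) R (bcoact r) (\<lambda>\<alpha> p. smul R (counit A \<alpha>) p) =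
    sweedler R R (comul R r) (\<lambda>r1 r2. sweedler J R (rcoact R r2) (\<lambda>h p. smul R (counit R r1) (smul R (counit J h) p)))"
    by (simp add: bcoact_def counit_A sweedler_sweedler[where Z=R] sweedler_tens[where Z=R] lin_rules pull_out
        cong: sweedler_cong)
  also have "\<dots> = sweedler R R (comul R r) (\<lambda>r1 r2. smul R (counit R r1) (sweedler J R (rcoact R r2) (\<lambda>h p. smul R (counit J h) p)))"
    by (intro sweedler_cong refl lin_sweedler_apply[symmetric, where Y=R and Z=R]) (assumption | rule lin_rules)+
  also have "\<dots> = r"
    by (simp add: coact_counit comul_counit1_R lin_rules cong: sweedler_cong)
  finally show ?thesis .
qed

text \<open>The counit of \<open>J\<close> applied to the second factor, a linear retraction of
  \<open>bos_R R J\<close>.\<close>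

definition bproj :: "('k, 'r, 'j) tens \<Rightarrow> 'r" where
  "bproj \<alpha> = sweedler R J \<alpha> (\<lambda>r a. smul R (counit J a) r)"

lemma lin_bproj: "lin (tensor R J) R bproj"
  unfolding bproj_def by (assumption | rule lin_rules)+

lemma left_coideal: "left_coideal A R bcoact (bos_R R J) bproj"
proof (unfold_locales, unfold bosonization_simps)
  show "bcoact (unity R) = tens (tensor R J) R (unity A) (unity R)"
    by (simp add: bcoact_def comul_unity_R coact_unity unity_A sweedler_tens[where Z="tensor (tensor R J) R"] lin_rules)
  show "lin R (tensor R J) (bos_R R J)"
    unfolding bos_R_def by (assumption | rule lin_rules)+
  show "bos_R R J (mul R r s) = mul A (bos_R R J r) (bos_R R J s)" if [lin_rules]: "r \<in> carr R" "s \<in> carr R" for r s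
    by (simp add: bos_R_def mul_A comul_unity_J act_unity mul_unity_J sweedler_tens[where Z="tensor R J"] lin_rules)
  show "comul A (bos_R R J r) = sweedler (tensor R J) R (bcoact r) (\<lambda>\<alpha> p. tens (tensor R J) (tensor R J) \<alpha> (bos_R R J p))"
    if [lin_rules]: "r \<in> carr R" for r
    by (simp add: bos_R_def comul_A bcoact_def comul_unity_J mul_unity_J sweedler_tens[where Z="tensor (tensor R J) (tensor R J)"]
       sweedler_sweedler[where Z="tensor (tensor R J) (tensor R J)"] lin_rules cong: sweedler_cong)
  show "bproj (bos_R R J r) = r" if [lin_rules]: "r \<in> carr R" for r
    by (simp add: bproj_def bos_R_def sweedler_tens[where Z=R] counit_unity_J k_space_smul(4)[OF k_space_R] lin_rules)
  show "bos_R R J (unity R) = unity A"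
    by (simp add: unity_A bos_R_def)
  show "unity A \<in> carr (tensor R J)"
    unfolding unity_A by (assumption | rule lin_rules)+
qed (assumption | rule bilin_mul_A lin_comul_A lin_counit_A lin_bcoact lin_bproj k_space_bosonization algebra_R
    bcoact_mul bcoact_coassoc bcoact_counit)+

end

section \<open>Uniqueness of the product, and primitive elements\<close>

lemma tspan_mem:
  fixes X :: "('k::field, 'a::ab_group_add, 'm) vs_scheme" and Y :: "('k, 'b::ab_group_add, 'n) vs_scheme"
  assumes X: "k_space X" and Z: "k_space Z" and f: "lin (tensor X Y) Z f"
    and sub: "C \<subseteq> carr X" "D \<subseteq> carr Y"
    and U: "module.subspace (smul Z) U" "\<And>x y. x \<in> C \<Longrightarrow> y \<in> D \<Longrightarrow> f (tens X Y x y) \<in> U"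
    and t: "t \<in> tspan X Y C D"
  shows "t \<in> carr (tensor X Y) \<and> f t \<in> U"
proof -
  interpret t: vector_space "tscale :: 'k \<Rightarrow> ('k, 'a, 'b) tens \<Rightarrow> _" by (rule vector_space_tscale)
  interpret z: vector_space "smul Z" using Z by (simp add: k_space_def)
  show ?thesis using t unfolding tspan_def
  proof (induction rule: t.span_induct_alt)
    case base
    show ?case using lin_zero[OF k_space_tensor Z f] z.subspace_0[OF U(1)] k_spaceD(1)[OF k_space_tensor] by metis
  next
    case (step c x y)
    then obtain p q where "p \<in> C" "q \<in> D" "x = tens X Y p q" by blast
    then have x: "x \<in> carr (tensor X Y)" "f x \<in> U"
      using sub U(2) by (auto intro!: tens_mem)
    have y: "y \<in> carr (tensor X Y)" "f y \<in> U" using step by auto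
    have *: "f (tscale c x + y) = smul Z c (f x) + f y"
      by (simp add: linD(2)[OF f] linD(3)[OF f, unfolded smul_tensor] x y tscale_mem)
    show ?case unfolding *
      by (intro conjI z.subspace_add[OF U(1)] z.subspace_scale[OF U(1)] k_spaceD(2)[OF k_space_tensor] tscale_mem x y)
  qed
qed

text \<open>Supplies the subspace condition of \<open>generated_by\<close> when two products are
  compared: the elements on which they agree form a subspace, and only the unit, the generators and
  closure under products remain.\<close>

lemma subspace_equalizer:
  assumes X: "k_space X" and Z: "k_space Z"
    and F: "\<And>g. g \<in> G \<Longrightarrow> lin X Z (F g)" and F': "\<And>g. g \<in> G \<Longrightarrow> lin X Z (F' g)"
  shows "module.subspace (smul X) {x \<in> carr X. \<forall>g\<in>G. F g x = F' g x}"
proof -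
  interpret x: vector_space "smul X" using X by (simp add: k_space_def)
  show ?thesis
    by (rule x.subspaceI)
      (auto simp: k_spaceD[OF X] linD(2,3)[OF F] linD(2,3)[OF F'] lin_zero[OF X Z F] lin_zero[OF X Z F'])
qed

lemma tspan_lin_eq:
  assumes X: "k_space X" and Z: "k_space Z" and f: "lin (tensor X Y) Z f" and g: "lin (tensor X Y) Z g"
    and sub: "C \<subseteq> carr X" "D \<subseteq> carr Y"
    and eq: "\<And>x y. x \<in> C \<Longrightarrow> y \<in> D \<Longrightarrow> f (tens X Y x y) = g (tens X Y x y)"
    and t: "t \<in> tspan X Y C D"
  shows "f t = g t"
proof -
  \<comment> \<open>A single pair of maps is compared, so the index set is a singleton.\<close>
  have "module.subspace (smul (tensor X Y)) {x \<in> carr (tensor X Y). \<forall>g'\<in>{()}. f x = g x}"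
    by (rule subspace_equalizer[OF k_space_tensor Z]) (rule f g)+
  from tspan_mem[OF X k_space_tensor lin_ident sub this _ t]
  show ?thesis using eq sub by (auto simp: tens_mem subset_iff)
qed

text \<open>The target is an arbitrary abelian group, so that sums whose summands have vanished
  during simplification can be rewritten directly.\<close>

lemma sweedler_zero:
  fixes X :: "('k::field, 'a::ab_group_add, 'm) vs_scheme" and Y :: "('k, 'b::ab_group_add, 'n) vs_scheme"
  assumes "k_space X" and "t \<in> carr (tensor X Y)"
  shows "sweedler X Y t (\<lambda>x y. 0) = (0 :: 'c::ab_group_add)"
proof -
  have 0: "(\<Sum>(x, y)\<leftarrow>ps. 0) = (0 :: 'c)" for ps :: "('a \<times> 'b) list"
    by (induction ps) auto
  show ?thesis
    unfolding sweedler_def 0 by (rule the_equality) (use tensor_sum[OF assms] in auto)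
qed

lemma sweedler_add:
  assumes "k_space X" and "k_space Z" and "bilin X Y Z B"
    and "t \<in> carr (tensor X Y)" and "u \<in> carr (tensor X Y)"
  shows "sweedler X Y (t + u) B = sweedler X Y t B + sweedler X Y u B"
  by (rule linD(2)[OF lin_sweedler[OF assms(1-3)] assms(4,5)])

section \<open>Uniqueness of the product\<close>

context coideal_pair
begin

text \<open>Two inductions over generators. First \<open>w\<close> is a generator of
  \<open>S\<close> and \<open>r\<close> grows: by \<open>coact_GS\<close> the product of
  \<open>w\<close> and \<open>r\<close> only has \<open>S\<close>-components in the span of 1 and
  \<open>GS\<close>, so the next factor from \<open>R\<close> again meets a known case. Then
  \<open>s\<close> grows by associativity.\<close>

lemma boson_unique:
  assumes alg: "algebra \<lparr>carr = carr (tensor R S), smul = smul (tensor R S), mul = m, unity = tens R S (unity R) (unity S)\<rparr>"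
    and m_R: "\<And>r r'. r \<in> carr R \<Longrightarrow> r' \<in> carr R \<Longrightarrow>
      m (tens R S r (unity S)) (tens R S r' (unity S)) = tens R S (mul R r r') (unity S)"
    and m_S: "\<And>s s'. s \<in> carr S \<Longrightarrow> s' \<in> carr S \<Longrightarrow>
      m (tens R S (unity R) s) (tens R S (unity R) s') = tens R S (unity R) (mul S s s')"
    and m_RS: "\<And>r s. r \<in> carr R \<Longrightarrow> s \<in> carr S \<Longrightarrow>
      m (tens R S r (unity S)) (tens R S (unity R) s) = tens R S r s"
    and GR: "generated_by R GR" "GR \<subseteq> carr R" and GS: "generated_by S GS" "GS \<subseteq> carr S"
    and coact_GS: "\<And>w. w \<in> GS \<Longrightarrow> \<epsilon> w \<in> tspan H S (carr H) (insert (unity S) GS)"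
    and m_SR: "\<And>v w. v \<in> GR \<Longrightarrow> w \<in> GS \<Longrightarrow>
      m (tens R S (unity R) w) (tens R S v (unity S)) = boson (tens R S (unity R) w) (tens R S v (unity S))"
    and z: "z \<in> carr (tensor R S)" and z': "z' \<in> carr (tensor R S)"
  shows "m z z' = boson z z'"
proof -
  have bilin_m: "bilin (tensor R S) (tensor R S) (tensor R S) m"
    using alg by (simp add: algebra_def bilin_def lin_def)
  have m_assoc: "m (m x y) z = m x (m y z)"
    if "x \<in> carr (tensor R S)" "y \<in> carr (tensor R S)" "z \<in> carr (tensor R S)" for x y z
    using alg that by (simp add: algebra_def)
  have m_unity: "m (tens R S (unity R) (unity S)) x = x" "m x (tens R S (unity R) (unity S)) = x"
    if "x \<in> carr (tensor R S)" for x
    using alg that by (simp_all add: algebra_def)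
  note [lin_rules] = bilin_comp1[OF bilin_m] bilin_comp2[OF bilin_m] bilin_mem[OF bilin_m]
  \<comment> \<open>Left multiplication by \<open>R\<close> and right multiplication by
    \<open>S\<close> are forced by the rules within \<open>R\<close> and \<open>S\<close> and by
    \<open>m_RS\<close>; the only open question is the product of an element of \<open>S\<close>
    followed by one of \<open>R\<close>.\<close>
  have left: "m (tens R S q (unity S)) x = boson (tens R S q (unity S)) x"
    if [lin_rules]: "q \<in> carr R" and x: "x \<in> carr (tensor R S)" for q x
  proof (rule tensor_lin_unique[OF A.k_space_R k_space_tensor _ _ _ x])
    fix r s assume [lin_rules]: "r \<in> carr R" "s \<in> carr S"
    have "m (tens R S q (unity S)) (tens R S r s) =
      m (m (tens R S q (unity S)) (tens R S r (unity S))) (tens R S (unity R) s)"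
      by (simp add: m_assoc m_RS lin_rules)
    then show "m (tens R S q (unity S)) (tens R S r s) = boson (tens R S q (unity S)) (tens R S r s)"
      by (simp add: m_R m_RS boson_left lin_rules)
  qed (assumption | rule lin_rules)+
  have right: "m x (tens R S (unity R) p) = boson x (tens R S (unity R) p)"
    if [lin_rules]: "p \<in> carr S" and x: "x \<in> carr (tensor R S)" for p x
  proof (rule tensor_lin_unique[OF A.k_space_R k_space_tensor _ _ _ x])
    fix r s assume [lin_rules]: "r \<in> carr R" "s \<in> carr S"
    have "m (tens R S r s) (tens R S (unity R) p) =
      m (tens R S r (unity S)) (m (tens R S (unity R) s) (tens R S (unity R) p))"
      by (simp add: m_assoc[symmetric] m_RS lin_rules)
    then show "m (tens R S r s) (tens R S (unity R) p) = boson (tens R S r s) (tens R S (unity R) p)"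
      by (simp add: m_S m_RS boson_right lin_rules)
  qed (assumption | rule lin_rules)+
  have split: "m (tens R S r s) x = m (tens R S r (unity S)) (m (tens R S (unity R) s) x)"
    "boson (tens R S r s) x = boson (tens R S r (unity S)) (boson (tens R S (unity R) s) x)"
    if [lin_rules]: "r \<in> carr R" "s \<in> carr S" "x \<in> carr (tensor R S)" for r s x
    by (simp_all add: m_assoc[symmetric] boson_assoc[symmetric] m_RS boson_left lin_rules)
  have unit: "m (tens R S (unity R) (unity S)) x = boson (tens R S (unity R) (unity S)) x"
    if "x \<in> carr (tensor R S)" for x
    using that by (rule left[rotated]) (rule lin_rules)
  have GS_R: "m (tens R S (unity R) w) (tens R S r (unity S)) = boson (tens R S (unity R) w) (tens R S r (unity S))"
    if "w \<in> GS" "r \<in> carr R" for w r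
  proof -
    \<comment> \<open>All generators \<open>w\<close> are treated at once: multiplying by
      \<open>r\<close> turns one generator into a combination of several, and each of them then
      meets \<open>r'\<close>.\<close>
    define U where "U = {r \<in> carr R. \<forall>w\<in>GS. m (tens R S (unity R) w) (tens R S r (unity S)) =
      boson (tens R S (unity R) w) (tens R S r (unity S))}"
    have "mul R r r' \<in> U" if r: "r \<in> U" and r': "r' \<in> U" for r r'
    proof -
      have [lin_rules]: "r \<in> carr R" "r' \<in> carr R" using r r' by (auto simp: U_def)
      have "m (tens R S (unity R) w) (tens R S (mul R r r') (unity S)) =
        boson (tens R S (unity R) w) (tens R S (mul R r r') (unity S))" if w: "w \<in> GS" for w
      proof -
        have [lin_rules]: "w \<in> carr S" using w GS by auto
        \<comment> \<open>The product of \<open>w\<close> and \<open>r\<close> is \<open>?f\<close>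
          at the coaction of \<open>w\<close>. As that tensor lies in the span given by
          \<open>coact_GS\<close>, it is enough to compare at x \<otimes> p with \<open>p\<close>
          either 1 or a generator.\<close>
        let ?f = "\<lambda>t. sweedler H S t (\<lambda>x p. tens R S (lact x r) p)"
        have 1: "boson (tens R S (unity R) w) (tens R S r (unity S)) = ?f (\<epsilon> w)"
          by (simp add: boson_tens lin_rules cong: sweedler_cong)
        have "m (?f (\<epsilon> w)) (tens R S r' (unity S)) = boson (?f (\<epsilon> w)) (tens R S r' (unity S))"
        proof (rule tspan_lin_eq[OF H.k_space_A k_space_tensor _ _ subset_refl _ _ coact_GS[OF w]])
          show "insert (unity S) GS \<subseteq> carr S" using GS by (auto intro: lin_rules)
          fix x p assume [lin_rules]: "x \<in> carr H" and p: "p \<in> insert (unity S) GS"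
          then have [lin_rules]: "p \<in> carr S" using GS by (auto intro: lin_rules)
          \<comment> \<open>The case of the unit is \<open>unit\<close>; for a generator it is the
            induction hypothesis on \<open>r'\<close>.\<close>
          have "m (tens R S (unity R) p) (tens R S r' (unity S)) = boson (tens R S (unity R) p) (tens R S r' (unity S))"
            using p r' unit by (auto simp: U_def tens_mem lin_rules)
          then show "m (?f (tens H S x p)) (tens R S r' (unity S)) = boson (?f (tens H S x p)) (tens R S r' (unity S))"
            by (simp add: sweedler_tens[where Z="tensor R S"] split[of "lact x r" p] left lin_rules)
        qed (assumption | rule lin_rules)+
        moreover have "m (tens R S (unity R) w) (tens R S (mul R r r') (unity S)) =
          m (m (tens R S (unity R) w) (tens R S r (unity S))) (tens R S r' (unity S))"
          by (simp add: m_assoc m_R lin_rules)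
        moreover have "boson (tens R S (unity R) w) (tens R S (mul R r r') (unity S)) =
          boson (boson (tens R S (unity R) w) (tens R S r (unity S))) (tens R S r' (unity S))"
          by (simp add: boson_assoc boson_left lin_rules)
        moreover have "m (tens R S (unity R) w) (tens R S r (unity S)) = ?f (\<epsilon> w)"
          using r w 1 by (simp add: U_def)
        ultimately show ?thesis using 1 by simp
      qed
      then show ?thesis by (simp add: U_def lin_rules)
    qed
    moreover have "module.subspace (smul R) U"
      unfolding U_def
    proof (rule subspace_equalizer[OF A.k_space_R k_space_tensor])
      fix w assume "w \<in> GS"
      then have [lin_rules]: "w \<in> carr S" using GS by auto
      show "lin R (tensor R S) (\<lambda>r. m (tens R S (unity R) w) (tens R S r (unity S)))"
        and "lin R (tensor R S) (\<lambda>r. boson (tens R S (unity R) w) (tens R S r (unity S)))"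
        by (assumption | rule lin_rules)+
    qed
    moreover have "GR \<subseteq> U" using GR m_SR by (auto simp: U_def)
    moreover have "unity R \<in> U"
      using GS m_S by (auto simp: U_def lin_rules m_unity boson_right subset_iff)
    ultimately have "carr R \<subseteq> U"
      using GR(1) unfolding generated_by_def by blast
    then show ?thesis using that by (auto simp: U_def)
  qed
  have SR: "m (tens R S (unity R) s) (tens R S r (unity S)) = boson (tens R S (unity R) s) (tens R S r (unity S))"
    if "s \<in> carr S" "r \<in> carr R" for s r
  proof -
    define U where "U = {s \<in> carr S. \<forall>r\<in>carr R. m (tens R S (unity R) s) (tens R S r (unity S)) =
      boson (tens R S (unity R) s) (tens R S r (unity S))}"
    \<comment> \<open>Agreement must reach arbitrary tensors, since in the product of
      \<open>s\<close>, \<open>s'\<close> and \<open>r\<close> the element \<open>s\<close>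
      multiplies a general element of R \<otimes> S.\<close>
    have all: "m (tens R S (unity R) s) x = boson (tens R S (unity R) s) x"
      if s: "s \<in> U" and x: "x \<in> carr (tensor R S)" for s x
    proof -
      have [lin_rules]: "s \<in> carr S" using s by (simp add: U_def)
      show ?thesis
      proof (rule tensor_lin_unique[OF A.k_space_R k_space_tensor _ _ _ x])
        fix r p assume rp [lin_rules]: "r \<in> carr R" "p \<in> carr S"
        have "m (tens R S (unity R) s) (tens R S r p) =
          m (m (tens R S (unity R) s) (tens R S r (unity S))) (tens R S (unity R) p)"
          by (simp add: m_assoc m_RS lin_rules)
        also have "\<dots> = boson (boson (tens R S (unity R) s) (tens R S r (unity S))) (tens R S (unity R) p)"
          using s by (simp add: U_def right lin_rules)
        also have "\<dots> = boson (tens R S (unity R) s) (tens R S r p)"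
          by (simp add: boson_assoc boson_right lin_rules)
        finally show "m (tens R S (unity R) s) (tens R S r p) = boson (tens R S (unity R) s) (tens R S r p)" .
      qed (assumption | rule lin_rules)+
    qed
    have "mul S s s' \<in> U" if s: "s \<in> U" and s': "s' \<in> U" for s s'
    proof -
      have [lin_rules]: "s \<in> carr S" "s' \<in> carr S" using s s' by (auto simp: U_def)
      have "m (tens R S (unity R) (mul S s s')) (tens R S r (unity S)) =
        boson (tens R S (unity R) (mul S s s')) (tens R S r (unity S))" if [lin_rules]: "r \<in> carr R" for r
      proof -
        have "m (tens R S (unity R) (mul S s s')) (tens R S r (unity S)) =
          m (tens R S (unity R) s) (m (tens R S (unity R) s') (tens R S r (unity S)))"
          by (simp add: m_assoc[symmetric] m_S lin_rules)
        also have "\<dots> = boson (tens R S (unity R) s) (boson (tens R S (unity R) s') (tens R S r (unity S)))"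
          by (simp add: all s s' lin_rules)
        also have "\<dots> = boson (tens R S (unity R) (mul S s s')) (tens R S r (unity S))"
          by (simp add: boson_assoc[symmetric] boson_right lin_rules)
        finally show ?thesis .
      qed
      then show ?thesis by (simp add: U_def lin_rules)
    qed
    moreover have "module.subspace (smul S) U"
      unfolding U_def
    proof (rule subspace_equalizer[OF H.k_space_R k_space_tensor])
      fix r assume [lin_rules]: "r \<in> carr R"
      show "lin S (tensor R S) (\<lambda>s. m (tens R S (unity R) s) (tens R S r (unity S)))"
        and "lin S (tensor R S) (\<lambda>s. boson (tens R S (unity R) s) (tens R S r (unity S)))"
        by (assumption | rule lin_rules)+
    qed
    moreover have "GS \<subseteq> U" using GS GS_R by (auto simp: U_def)
    moreover have "unity S \<in> U" by (simp add: U_def unit lin_rules)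
    ultimately have "carr S \<subseteq> U"
      using GS(1) unfolding generated_by_def by blast
    then show ?thesis using that by (auto simp: U_def)
  qed
  show ?thesis
  proof (rule tensor_lin_unique[OF A.k_space_R k_space_tensor _ _ _ z])
    fix r s assume rs [lin_rules]: "r \<in> carr R" "s \<in> carr S"
    show "m (tens R S r s) z' = boson (tens R S r s) z'"
    proof (rule tensor_lin_unique[OF A.k_space_R k_space_tensor _ _ _ z'])
      fix r' s' assume rs' [lin_rules]: "r' \<in> carr R" "s' \<in> carr S"
      \<comment> \<open>Bracketing as r ((s r') s') isolates the middle product, which
        \<open>SR\<close> determines; the outer ones are given by \<open>left\<close> and
        \<open>right\<close>.\<close>
      have "m (tens R S r s) (tens R S r' s') =
        m (tens R S r (unity S)) (m (m (tens R S (unity R) s) (tens R S r' (unity S))) (tens R S (unity R) s'))"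
        by (simp add: split[of r s] m_assoc m_RS lin_rules)
      also have "\<dots> = boson (tens R S r (unity S)) (boson (boson (tens R S (unity R) s) (tens R S r' (unity S))) (tens R S (unity R) s'))"
        by (simp add: SR left right lin_rules)
      also have "\<dots> = boson (tens R S r s) (tens R S r' s')"
        by (simp add: split[of r s] boson_assoc boson_right lin_rules)
      finally show "m (tens R S r s) (tens R S r' s') = boson (tens R S r s) (tens R S r' s')" .
    qed (assumption | rule lin_rules z z')+
  qed (assumption | rule lin_rules z z')+
qed

end

section \<open>Primitivity in degree one\<close>

locale pre_nichols_algebra =
  fixes J :: "('k::field, 'j::ab_group_add, 'm) hopf_scheme" and V :: "('k, 'v::ab_group_add, 'j, 'o) yd_scheme"
    and R :: "('k, 'r::ab_group_add, 'j, 'n) yd_bialg_scheme" and \<iota> :: "'v \<Rightarrow> 'r"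
  assumes hopf_J: "hopf_algebra J" and yd_V: "yd_module J V (act V) (coact V)" and nichols: "pre_nichols J V R \<iota>"
begin

sublocale braided J R
  by unfold_locales (use hopf_J nichols in \<open>simp_all add: pre_nichols_def graded_braided_bialgebra_def\<close>)

lemma k_space_V [lin_rules]: "k_space V" and lin_coact_V: "lin V (tensor J V) (coact V)"
  using yd_V by (simp_all add: yd_module_def alg_rep_def)

lemma lin_\<iota>: "lin V R \<iota>" and image_\<iota>: "\<iota> ` carr V = grade R 1" and generated: "generated_by R (grade R 1)"
  and rcoact_\<iota>: "\<And>v. v \<in> carr V \<Longrightarrow> rcoact R (\<iota> v) = sweedler J V (coact V v) (\<lambda>h v'. tens J R h (\<iota> v'))"
  and grade_0: "grade R 0 = {smul R c (unity R) | c. True}"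
  using nichols by (simp_all add: pre_nichols_def bij_betw_def)

lemmas [lin_rules] = lin_comp[OF lin_\<iota>] lin_mem[OF lin_\<iota>] lin_comp[OF lin_coact_V] lin_mem[OF lin_coact_V]

lemma grade_subspace: "module.subspace (smul R) (grade R n)" and grade_subset: "grade R n \<subseteq> carr R"
  and counit_grade_1: "r \<in> grade R 1 \<Longrightarrow> counit R r = 0"
  and comul_grade_1: "r \<in> grade R 1 \<Longrightarrow>
    comul R r \<in> module.span tscale (\<Union>i\<le>1. tspan R R (grade R i) (grade R (1 - i)))"
  and rcoact_grade: "r \<in> grade R n \<Longrightarrow> rcoact R r \<in> tspan J R (carr J) (grade R n)"
  using nichols by (auto simp: pre_nichols_def graded_braided_bialgebra_def direct_sum_def)

text \<open>By the grading the coproduct lies in R(0) \<otimes> R(1) + R(1) \<otimes> R(0). As R(0)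
  is spanned by the unit, it has the form 1 \<otimes> a + b \<otimes> 1, and the two counit laws
  give a = r and b = r because the counit vanishes in degree one.\<close>

lemma primitive:
  assumes r: "r \<in> grade R 1"
  shows "comul R r = tens R R (unity R) r + tens R R r (unity R)"
proof -
  interpret t: vector_space "tscale :: 'k \<Rightarrow> ('k, 'r, 'r) tens \<Rightarrow> _" by (rule vector_space_tscale)
  interpret v: vector_space "smul R" using k_space_R by (simp add: k_space_def)
  note s = grade_subspace[of 1] and in_R = subsetD[OF grade_subset[of 1]]
  define U where "U = {tens R R (unity R) a + tens R R b (unity R) | a b. a \<in> grade R 1 \<and> b \<in> grade R 1}"
  have add: "tens R R x y + tens R R x y' = tens R R x (y + y')" "tens R R y x + tens R R y' x = tens R R (y + y') x"
    if "x \<in> carr R" "y \<in> carr R" "y' \<in> carr R" for x y y'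
    using that linD(2)[OF bilinD(1)[OF bilin_tens]] linD(2)[OF bilinD(2)[OF bilin_tens]] by metis+
  have scale: "tscale c (tens R R x y) = tens R R x (smul R c y)" "tscale c (tens R R x y) = tens R R (smul R c x) y"
    if "x \<in> carr R" "y \<in> carr R" for c x y
    using that bilin_scale[OF bilin_tens, unfolded smul_tensor] by metis+
  have zero: "tens R R x 0 = 0" "tens R R 0 x = 0" if "x \<in> carr R" for x
    using lin_zero[OF k_space_R k_space_tensor bilinD(1)[OF bilin_tens that]]
      lin_zero[OF k_space_R k_space_tensor bilinD(2)[OF bilin_tens that]] by simp_all
  have U: "t.subspace U"
  proof (rule t.subspaceI)
    show "0 \<in> U" unfolding U_def
      using v.subspace_0[OF s] by (intro CollectI exI[of _ 0]) (simp only: zero unity_R add_0_left simp_thms)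
    show "x + y \<in> U" if x: "x \<in> U" and y: "y \<in> U" for x y
    proof -
      obtain a b c d where *: "x = tens R R (unity R) a + tens R R b (unity R)" "y = tens R R (unity R) c + tens R R d (unity R)"
        "a \<in> grade R 1" "b \<in> grade R 1" "c \<in> grade R 1" "d \<in> grade R 1"
        using x y unfolding U_def by blast
      have "x + y = (tens R R (unity R) a + tens R R (unity R) c) + (tens R R b (unity R) + tens R R d (unity R))"
        unfolding * by (rule add.assoc[THEN trans], subst add.left_commute[of "tens R R b (unity R)"], rule add.assoc[symmetric])
      also have "\<dots> = tens R R (unity R) (a + c) + tens R R (b + d) (unity R)"
        using add unity_R * in_R by metis
      finally show ?thesis
        unfolding U_def using * v.subspace_add[OF s] by blast
    qed
    show "tscale c x \<in> U" if x: "x \<in> U" for c x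
    proof -
      obtain a b where *: "x = tens R R (unity R) a + tens R R b (unity R)" "a \<in> grade R 1" "b \<in> grade R 1"
        using x unfolding U_def by blast
      have "tscale c x = tens R R (unity R) (smul R c a) + tens R R (smul R c b) (unity R)"
        unfolding * t.scale_right_distrib using scale unity_R * in_R by metis
      then show ?thesis
        unfolding U_def using * v.subspace_scale[OF s] by blast
    qed
  qed
  have "tspan R R (grade R i) (grade R (1 - i)) \<subseteq> U" if le: "i \<le> 1" for i :: nat
    unfolding tspan_def
  proof (rule t.span_minimal[OF _ U], safe)
    fix x y assume x: "x \<in> grade R i" and y: "y \<in> grade R (1 - i)"
    consider "i = 0" | "i = 1" using le by linarith
    then show "tens R R x y \<in> U"
    proof cases
      case 1
      then obtain c where c: "x = smul R c (unity R)" using x grade_0 by auto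
      have y': "y \<in> grade R 1" using y 1 by simp
      \<comment> \<open>The scalar from R(0) moves across the tensor sign, and a zero tensor fills
        the other summand of the form defining \<open>U\<close>.\<close>
      have "tens R R x y = tens R R (unity R) (smul R c y) + tens R R 0 (unity R)"
        using scale zero unity_R y' in_R by (metis add.right_neutral c)
      then show ?thesis unfolding U_def using y' v.subspace_scale[OF s] v.subspace_0[OF s] by blast
    next
      case 2
      then obtain c where c: "y = smul R c (unity R)" using y grade_0 by auto
      have x': "x \<in> grade R 1" using x 2 by simp
      have "tens R R x y = tens R R (unity R) 0 + tens R R (smul R c x) (unity R)"
        using scale zero unity_R x' in_R by (metis add.left_neutral c)
      then show ?thesis unfolding U_def using x' v.subspace_scale[OF s] v.subspace_0[OF s] by blast
    qed
  qed
  then have "t.span (\<Union>i\<le>1. tspan R R (grade R i) (grade R (1 - i))) \<subseteq> U"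
    by (intro t.span_minimal[OF _ U] UN_least) auto
  then obtain a b where ab: "a \<in> grade R 1" "b \<in> grade R 1" and
    comul: "comul R r = tens R R (unity R) a + tens R R b (unity R)"
    using comul_grade_1[OF r] unfolding U_def by blast
  have [lin_rules]: "a \<in> carr R" "b \<in> carr R" "r \<in> carr R" using ab r in_R by auto
  have "sweedler R R (comul R r) (\<lambda>c1 c2. smul R (counit R c1) c2) = smul R (counit R (unity R)) a + smul R (counit R b) (unity R)"
    unfolding comul by (subst sweedler_add[where Z=R]) (simp_all add: sweedler_tens[where Z=R] lin_rules)
  then have "a = r"
    using ab by (simp add: comul_counit1_R counit_unity_R counit_grade_1 k_space_smul[OF k_space_R] lin_rules)
  have "sweedler R R (comul R r) (\<lambda>c1 c2. smul R (counit R c2) c1) = smul R (counit R a) (unity R) + smul R (counit R (unity R)) b"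
    unfolding comul by (subst sweedler_add[where Z=R]) (simp_all add: sweedler_tens[where Z=R] lin_rules)
  then have "b = r"
    using ab by (simp add: comul_counit2_R counit_unity_R counit_grade_1 k_space_smul[OF k_space_R] lin_rules)
  show ?thesis using comul \<open>a = r\<close> \<open>b = r\<close> by simp
qed

text \<open>Of the two primitive summands, r \<otimes> 1 contributes the first term, since the
  coaction on the unit is trivial, and 1 \<otimes> r contributes the coaction of
  \<open>r\<close>.\<close>

lemma bcoact_grade_1:
  assumes "r \<in> grade R 1"
  shows "bcoact r = tens (tensor R J) R (bos_R R J r) (unity R) +
    sweedler J R (rcoact R r) (\<lambda>h p. tens (tensor R J) R (bos_J R J h) p)"
proof -
  have [lin_rules]: "r \<in> carr R" using assms grade_subset by blast
  show ?thesis
    unfolding bcoact_def primitive[OF assms]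
    by (subst sweedler_add[where Z="tensor (tensor R J) R"])
      (simp_all add: bos_R_def bos_J_def coact_unity sweedler_tens[where Z="tensor (tensor R J) R"] add.commute lin_rules)
qed

end

section \<open>The generalized q-boson algebra\<close>

locale q_boson_data =
  fixes J :: "('k::field, 'j::ab_group_add, 'm1) hopf_scheme" and K :: "('k, 'c::ab_group_add, 'm2) hopf_scheme"
    and \<tau>0 :: "'j \<Rightarrow> 'c \<Rightarrow> 'k"
    and V :: "('k, 'v::ab_group_add, 'j, 'm3) yd_scheme" and W :: "('k, 'w::ab_group_add, 'c, 'm4) yd_scheme"
    and \<tau>1 :: "'v \<Rightarrow> 'w \<Rightarrow> 'k"
    and R :: "('k, 'r::ab_group_add, 'j, 'm5) yd_bialg_scheme" and \<iota> :: "'v \<Rightarrow> 'r"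
    and S :: "('k, 's::ab_group_add, 'c, 'm6) yd_bialg_scheme" and \<kappa> :: "'w \<Rightarrow> 's"
    and \<tau> :: "('k, 'r, 'j) tens \<Rightarrow> ('k, 's, 'c) tens \<Rightarrow> 'k"
  assumes data: "pairing_data J K \<tau>0 V W \<tau>1"
    and nichols_R: "pre_nichols J V R \<iota>" and nichols_S: "pre_nichols K W S \<kappa>"
    and extended: "extended_pairing J K \<tau>0 V W \<tau>1 R \<iota> S \<kappa> \<tau>"
begin

sublocale N: pre_nichols_algebra J V R \<iota>
  using data nichols_R by unfold_locales (simp_all add: pairing_data_def hopf_algebra_bij_def)

sublocale M: pre_nichols_algebra K W S \<kappa>
  using data nichols_S by unfold_locales (simp_all add: pairing_data_def hopf_algebra_bij_def)

sublocale coideal_pair "bosonization R J" R N.bcoact "bos_R R J" N.bproj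
    "bosonization S K" S M.bcoact "bos_R S K" M.bproj \<tau>
proof -
  interpret A: left_coideal "bosonization R J" R N.bcoact "bos_R R J" N.bproj by (rule N.left_coideal)
  interpret H: left_coideal "bosonization S K" S M.bcoact "bos_R S K" M.bproj by (rule M.left_coideal)
  show "coideal_pair (bosonization R J) R N.bcoact (bos_R R J) N.bproj
    (bosonization S K) S M.bcoact (bos_R S K) M.bproj \<tau>"
    by unfold_locales (use extended in \<open>simp add: extended_pairing_def\<close>)
qed

section \<open>The defining relation on generators\<close>

lemma \<tau>_values:
  "\<And>a x. a \<in> carr J \<Longrightarrow> x \<in> carr K \<Longrightarrow> \<tau> (bos_J R J a) (bos_J S K x) = \<tau>0 a x"
  "\<And>v w. v \<in> carr V \<Longrightarrow> w \<in> carr W \<Longrightarrow> \<tau> (bos_R R J (\<iota> v)) (bos_R S K (\<kappa> w)) = \<tau>1 v w"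
  "\<And>a w. a \<in> carr J \<Longrightarrow> w \<in> carr W \<Longrightarrow> \<tau> (bos_J R J a) (bos_R S K (\<kappa> w)) = 0"
  "\<And>v x. v \<in> carr V \<Longrightarrow> x \<in> carr K \<Longrightarrow> \<tau> (bos_R R J (\<iota> v)) (bos_J S K x) = 0"
  using extended by (simp_all add: extended_pairing_def)

lemma bilin_\<tau>0: "bilin J K ground \<tau>0"
  using data by (simp add: pairing_data_def skew_pairing_def)

lemma lin_bos_J:
  shows "lin X J f \<Longrightarrow> lin X (bosonization R J) (\<lambda>x. bos_J R J (f x))" "h \<in> carr J \<Longrightarrow> bos_J R J h \<in> carr (bosonization R J)"
    and "lin Y K g \<Longrightarrow> lin Y (bosonization S K) (\<lambda>x. bos_J S K (g x))" "h' \<in> carr K \<Longrightarrow> bos_J S K h' \<in> carr (bosonization S K)"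
  unfolding bosonization_simps bos_J_def by (assumption | rule lin_rules)+

lemmas [lin_rules] = lin_bos_J bilin_comp1[OF bilin_\<tau>0] bilin_comp2[OF bilin_\<tau>0]

lemma bcoact_\<iota>:
  assumes [lin_rules]: "v \<in> carr V"
  shows "N.bcoact (\<iota> v) = tens (bosonization R J) R (bos_R R J (\<iota> v)) (unity R) +
    sweedler J V (coact V v) (\<lambda>h v'. tens (bosonization R J) R (bos_J R J h) (\<iota> v'))"
proof -
  have 1: "\<iota> v \<in> grade R 1" using assms N.image_\<iota> by blast
  show ?thesis
    unfolding N.bcoact_grade_1[OF 1] N.rcoact_\<iota>[OF assms] tensor_bosonization(1)[symmetric]
    by (simp add: sweedler_sweedler[where Z="tensor (bosonization R J) R"]
        sweedler_tens[where Z="tensor (bosonization R J) R"] lin_rules cong: sweedler_cong)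
qed

lemma bcoact_\<kappa>:
  assumes [lin_rules]: "w \<in> carr W"
  shows "M.bcoact (\<kappa> w) = tens (bosonization S K) S (bos_R S K (\<kappa> w)) (unity S) +
    sweedler K W (coact W w) (\<lambda>h w'. tens (bosonization S K) S (bos_J S K h) (\<kappa> w'))"
proof -
  have 1: "\<kappa> w \<in> grade S 1" using assms M.image_\<iota> by blast
  show ?thesis
    unfolding M.bcoact_grade_1[OF 1] M.rcoact_\<iota>[OF assms] tensor_bosonization(1)[symmetric]
    by (simp add: sweedler_sweedler[where Z="tensor (bosonization S K) S"]
        sweedler_tens[where Z="tensor (bosonization S K) S"] lin_rules cong: sweedler_cong)
qed

lemma lact_\<iota>:
  assumes [lin_rules]: "v \<in> carr V" "x \<in> carr (bosonization S K)"
  shows "lact x (\<iota> v) = smul R (\<tau> (bos_R R J (\<iota> v)) x) (unity R) +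
    sweedler J V (coact V v) (\<lambda>h v'. smul R (\<tau> (bos_J R J h) x) (\<iota> v'))"
  unfolding lact_def bcoact_\<iota>[OF assms(1)]
  by (subst sweedler_add[where Z=R])
    (simp_all add: sweedler_sweedler[where Z=R] sweedler_tens[where Z=R] lin_rules cong: sweedler_cong)

text \<open>The coaction of \<open>\<kappa> w\<close> has two parts. In the first, \<open>w\<close>
  itself acts on \<open>v\<close> and yields the scalar \<open>\<tau>1 v w\<close>; in the second,
  its \<open>K\<close>-component acts on \<open>v\<close> through \<open>\<tau>0\<close> and leaves
  the quadratic term.\<close>

lemma boson_\<kappa>\<iota>:
  assumes [lin_rules]: "v \<in> carr V" "w \<in> carr W"
  shows "boson (tens R S (unity R) (\<kappa> w)) (tens R S (\<iota> v) (unity S)) =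
    sweedler J V (coact V v) (\<lambda>g v'. sweedler K W (coact W w) (\<lambda>h w'.
      tscale (\<tau>0 g h) (tens R S (\<iota> v') (\<kappa> w')))) + tscale (\<tau>1 v w) (tens R S (unity R) (unity S))"
proof -
  let ?Z = "tensor R S"
  have 1: "lact (bos_R S K (\<kappa> w)) (\<iota> v) = smul R (\<tau>1 v w) (unity R)"
    by (simp add: lact_\<iota> \<tau>_values sweedler_zero k_space_smul[OF N.k_space_R] lin_rules cong: sweedler_cong)
  \<comment> \<open>The pairing of \<open>V\<close> with \<open>K\<close> vanishes, so the scalar
    term drops out.\<close>
  have 2: "lact (bos_J S K g) (\<iota> v) = sweedler J V (coact V v) (\<lambda>h v'. smul R (\<tau>0 h g) (\<iota> v'))"
    if "g \<in> carr K" for g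
    using that by (simp add: lact_\<iota> \<tau>_values k_space_smul[OF N.k_space_R] lin_rules cong: sweedler_cong)
  have "boson (tens R S (unity R) (\<kappa> w)) (tens R S (\<iota> v) (unity S)) =
    sweedler (bosonization S K) S (M.bcoact (\<kappa> w)) (\<lambda>x p. tens R S (lact x (\<iota> v)) p)"
    by (simp add: boson_tens lin_rules cong: sweedler_cong)
  also have "\<dots> = tscale (\<tau>1 v w) (tens R S (unity R) (unity S)) +
    sweedler K W (coact W w) (\<lambda>h w'. sweedler J V (coact V v) (\<lambda>g v'.
      tscale (\<tau>0 g h) (tens R S (\<iota> v') (\<kappa> w'))))"
    unfolding bcoact_\<kappa>[OF assms(2)]
    by (subst sweedler_add[where Z="?Z"])
      (simp_all add: 1 2 sweedler_sweedler[where Z="?Z"] sweedler_tens[where Z="?Z"] lin_rules pull_out cong: sweedler_cong)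
  also have "sweedler K W (coact W w) (\<lambda>h w'. sweedler J V (coact V v) (\<lambda>g v'.
      tscale (\<tau>0 g h) (tens R S (\<iota> v') (\<kappa> w')))) =
    sweedler J V (coact V v) (\<lambda>g v'. sweedler K W (coact W w) (\<lambda>h w'.
      tscale (\<tau>0 g h) (tens R S (\<iota> v') (\<kappa> w'))))"
    by (rule sweedler_swap[where Z="?Z"]) (assumption | rule lin_rules)+
  finally show ?thesis by (simp only: add.commute)
qed

text \<open>Provides the condition \<open>coact_GS\<close> of \<open>boson_unique\<close>: the
  Yetter-Drinfeld coaction preserves degree one, and the remaining term of
  \<open>M.bcoact_grade_1\<close> has second leg 1.\<close>

lemma bcoact_grade_tspan:
  assumes "p \<in> grade S 1"
  shows "M.bcoact p \<in> tspan (bosonization S K) S (carr (bosonization S K)) (insert (unity S) (grade S 1))"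
    (is "_ \<in> ?T")
proof -
  interpret t: vector_space "tscale :: 'k \<Rightarrow> ('k, ('k, 's, 'c) tens, 's) tens \<Rightarrow> _" by (rule vector_space_tscale)
  have p [lin_rules]: "p \<in> carr S" using assms M.grade_subset by blast
  have gen: "tens (bosonization S K) S x y \<in> ?T"
    if "x \<in> carr (bosonization S K)" "y \<in> insert (unity S) (grade S 1)" for x y
    using that unfolding tspan_def by (intro t.span_base) blast
  have T: "t.subspace ?T" by (simp add: tspan_def t.subspace_span)
  let ?f = "\<lambda>t. sweedler K S t (\<lambda>h p. tens (bosonization S K) S (bos_J S K h) p)"
  have "?f (rcoact S p) \<in> ?T"
  proof (rule conjunct2[OF tspan_mem[OF M.k_space_J k_space_tensor _ subset_refl M.grade_subset _ _ M.rcoact_grade[OF assms]]])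
    show "module.subspace (smul (tensor (bosonization S K) S)) ?T"
      using T by (simp add: smul_tensor)
    show "lin (tensor K S) (tensor (bosonization S K) S) ?f"
      by (assumption | rule lin_rules)+
    fix h q assume 1: "h \<in> carr K" "q \<in> grade S 1"
    then have [lin_rules]: "h \<in> carr K" "q \<in> carr S" using M.grade_subset by blast+
    show "?f (tens K S h q) \<in> ?T"
      using 1 by (simp add: sweedler_tens[where Z="tensor (bosonization S K) S"] lin_rules gen del: One_nat_def)
  qed
  then show ?thesis
    unfolding M.bcoact_grade_1[OF assms] tensor_bosonization(1)[symmetric]
    by (intro t.subspace_add[OF T] gen) (auto intro: lin_rules)
qed

section \<open>Identification of the q-boson algebra with R # S\<close>

text \<open>The function \<open>boson\<close> set to 0 off the carrier, which is the normalization
  that \<open>q_boson_product\<close> demands.\<close>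

definition product :: "('k, 'r, 's) tens \<Rightarrow> ('k, 'r, 's) tens \<Rightarrow> ('k, 'r, 's) tens" where
  "product x y = (if x \<in> carr (tensor R S) \<and> y \<in> carr (tensor R S) then boson x y else 0)"

lemma q_boson_product_product: "q_boson_product J K \<tau>0 V W \<tau>1 R \<iota> S \<kappa> product"
proof -
  have "algebra \<lparr>carr = carr (tensor R S), smul = smul (tensor R S), mul = product, unity = tens R S (unity R) (unity S)\<rparr>"
  proof (rule algebra_image[OF algebra_boson_alg])
    show "k_space \<lparr>carr = carr (tensor R S), smul = smul (tensor R S), mul = product, unity = tens R S (unity R) (unity S)\<rparr>"
      using k_space_tensor[of R S] by (simp add: k_space_def)
    show "lin boson_alg \<lparr>carr = carr (tensor R S), smul = smul (tensor R S), mul = product, unity = tens R S (unity R) (unity S)\<rparr> (\<lambda>x. x)"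
      by (simp add: lin_def)
  qed (simp_all add: product_def)
  then show ?thesis
    unfolding q_boson_product_def
    by (simp add: product_def boson_\<kappa>\<iota> boson_left boson_right lin_rules)
qed

lemma q_boson_product_unique:
  assumes m: "q_boson_product J K \<tau>0 V W \<tau>1 R \<iota> S \<kappa> m"
  shows "m = product"
proof (rule ext, rule ext)
  fix x y
  show "m x y = product x y"
  proof (cases "x \<in> carr (tensor R S) \<and> y \<in> carr (tensor R S)")
    case True
    note facts = m[unfolded q_boson_product_def]
    \<comment> \<open>Elements of degree one are images under \<open>\<iota>\<close> and
      \<open>\<kappa>\<close>; on these the defining relation for \<open>m\<close> has the same
      right side as \<open>boson_\<kappa>\<iota>\<close>.\<close>
    have m_SR: "m (tens R S (unity R) w) (tens R S v (unity S)) = boson (tens R S (unity R) w) (tens R S v (unity S))"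
      if "v \<in> grade R 1" "w \<in> grade S 1" for v w
      using that facts unfolding N.image_\<iota>[symmetric] M.image_\<iota>[symmetric] by (auto simp: boson_\<kappa>\<iota>)
    have "m x y = boson x y"
      by (rule boson_unique[OF _ _ _ _ N.generated N.grade_subset M.generated M.grade_subset
            bcoact_grade_tspan m_SR]) (use facts True in blast)+
    then show ?thesis using True by (simp add: product_def)
  qed (use m in \<open>auto simp: q_boson_product_def product_def\<close>)
qed

lemma q_boson_eq:
  "q_boson J K \<tau>0 V W \<tau>1 R \<iota> S \<kappa> =
    \<lparr>carr = carr (tensor R S), smul = smul (tensor R S), mul = product, unity = tens R S (unity R) (unity S)\<rparr>"
proof -
  have "(THE m. q_boson_product J K \<tau>0 V W \<tau>1 R \<iota> S \<kappa> m) = product"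
    by (rule the_equality) (rule q_boson_product_product q_boson_product_unique, assumption?)+
  then show ?thesis by (simp add: q_boson_def)
qed

lemma RS_algebra_eq: "RS_algebra R J S K \<tau> = RS"
  by (simp add: RS_algebra_def RS_def)

lemma alg_iso_embed: "alg_iso (q_boson J K \<tau>0 V W \<tau>1 R \<iota> S \<kappa>) RS embed"
proof -
  have "lin (q_boson J K \<tau>0 V W \<tau>1 R \<iota> S \<kappa>) RS embed"
    using lin_embed by (simp add: lin_def q_boson_eq carr_RS RS_simps smul_tensor)
  moreover have "algebra (q_boson J K \<tau>0 V W \<tau>1 R \<iota> S \<kappa>)"
    using q_boson_product_product by (simp add: q_boson_product_def q_boson_eq)
  moreover have "inj_on embed (carr (tensor R S))"
    by (rule inj_on_inverseI) (rule unembed_embed)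
  ultimately show ?thesis
    by (simp add: alg_iso_def alg_hom_def algebra_RS unity_RS)
      (simp add: q_boson_eq product_def RS_simps embed_boson bij_betw_def carr_RS)
qed

lemma RS_elem_eq: "r \<in> carr R \<Longrightarrow> s \<in> carr S \<Longrightarrow> RS_elem R J S K r s = embed (tens R S r s)"
  by (simp add: RS_elem_def embed_tens)

text \<open>Each r \<otimes> s is the product of r \<otimes> 1 and 1 \<otimes> s, so a homomorphism
  is determined by its values on \<open>R\<close> and \<open>S\<close>.\<close>

lemma alg_hom_unique:
  assumes \<psi>: "alg_hom (q_boson J K \<tau>0 V W \<tau>1 R \<iota> S \<kappa>) RS \<psi>"
    and R: "\<And>r. r \<in> carr R \<Longrightarrow> \<psi> (tens R S r (unity S)) = RS_elem R J S K r (unity S)"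
    and S: "\<And>s. s \<in> carr S \<Longrightarrow> \<psi> (tens R S (unity R) s) = RS_elem R J S K (unity R) s"
    and x: "x \<in> carr (tensor R S)"
  shows "\<psi> x = embed x"
proof (rule tensor_lin_unique[OF N.k_space_R k_space_RS _ _ _ x])
  show "lin (tensor R S) RS \<psi>" and "lin (tensor R S) RS embed"
    using \<psi> alg_iso_embed by (simp_all add: alg_iso_def alg_hom_def q_boson_eq lin_def)
  fix r s assume [lin_rules]: "r \<in> carr R" "s \<in> carr S"
  have hom: "f (boson (tens R S r (unity S)) (tens R S (unity R) s)) =
      mul RS (f (tens R S r (unity S))) (f (tens R S (unity R) s))"
    if "alg_hom (q_boson J K \<tau>0 V W \<tau>1 R \<iota> S \<kappa>) RS f" for f
    using that by (simp add: alg_hom_def q_boson_eq product_def lin_rules)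
  show "\<psi> (tens R S r s) = embed (tens R S r s)"
    using hom[OF \<psi>] hom[of embed] alg_iso_embed
    by (simp add: alg_iso_def R S RS_elem_eq boson_left lin_rules)
qed

end

text \<open>The action \<open>hact\<close> takes values in the bosonization, so the formula for the
  representation is phrased with the element \<open>t\<close> of \<open>R\<close> that represents s
  \<triangleright> r'. It is unique because \<open>bos_R R J\<close> has a left inverse on
  \<open>R\<close>.\<close>

theorem proposition3p4:
  fixes J :: "('k::field, 'j::ab_group_add) hopf"
    and K :: "('k, 'c::ab_group_add) hopf"
    and \<tau>0 :: "'j \<Rightarrow> 'c \<Rightarrow> 'k"
    and V :: "('k, 'v::ab_group_add, 'j) yd"
    and W :: "('k, 'w::ab_group_add, 'c) yd"
    and \<tau>1 :: "'v \<Rightarrow> 'w \<Rightarrow> 'k"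
    and R :: "('k, 'r::ab_group_add, 'j) yd_bialg"
    and \<iota> :: "'v \<Rightarrow> 'r"
    and S :: "('k, 's::ab_group_add, 'c) yd_bialg"
    and \<kappa> :: "'w \<Rightarrow> 's"
    and \<tau> :: "('k, 'r, 'j) tens \<Rightarrow> ('k, 's, 'c) tens \<Rightarrow> 'k"
  assumes data: "pairing_data J K \<tau>0 V W \<tau>1"
    and R: "pre_nichols J V R \<iota>"
    and S: "pre_nichols K W S \<kappa>"
    and \<tau>: "extended_pairing J K \<tau>0 V W \<tau>1 R \<iota> S \<kappa> \<tau>"
  defines "\<B> \<equiv> q_boson J K \<tau>0 V W \<tau>1 R \<iota> S \<kappa>"
    and "A \<equiv> bosonization R J"
    and "H \<equiv> bosonization S K"
    and "RS \<equiv> RS_algebra R J S K \<tau>"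
  shows "(\<exists>\<phi>. alg_iso \<B> RS \<phi> \<and>
            (\<forall>r\<in>carr R. \<phi> (tens R S r (unity S)) = RS_elem R J S K r (unity S)) \<and>
            (\<forall>s\<in>carr S. \<phi> (tens R S (unity R) s) = RS_elem R J S K (unity R) s) \<and>
            (\<forall>\<psi>. alg_hom \<B> RS \<psi> \<and>
               (\<forall>r\<in>carr R. \<psi> (tens R S r (unity S)) = RS_elem R J S K r (unity S)) \<and>
               (\<forall>s\<in>carr S. \<psi> (tens R S (unity R) s) = RS_elem R J S K (unity R) s)
               \<longrightarrow> (\<forall>x\<in>carr \<B>. \<psi> x = \<phi> x)))
       \<and> (\<exists>\<rho>. alg_rep RS R \<rho> \<and>
            (\<forall>z\<in>carr RS. \<forall>r'\<in>carr R.
               bos_R R J (\<rho> z r') = smash_rep A H \<tau> z (bos_R R J r')) \<and>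
            (\<forall>r\<in>carr R. \<forall>s\<in>carr S. \<forall>r'\<in>carr R. \<exists>t\<in>carr R.
               bos_R R J t = hact A \<tau> (bos_R S K s) (bos_R R J r') \<and>
               \<rho> (RS_elem R J S K r s) r' = mul R r t))"
proof -
  interpret q_boson_data J K \<tau>0 V W \<tau>1 R \<iota> S \<kappa> \<tau>
    by unfold_locales (rule assms)+
  have iso: "alg_iso \<B> RS embed" and rep: "alg_rep RS R rep" and carr_\<B>: "carr \<B> = carr (tensor R S)"
    using alg_iso_embed alg_rep_rep unfolding assms(5-8) by (simp_all add: RS_algebra_eq q_boson_eq)
  have unique: "\<psi> x = embed x" if "alg_hom \<B> RS \<psi>"
    "\<forall>r\<in>carr R. \<psi> (tens R S r (unity S)) = RS_elem R J S K r (unity S)"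
    "\<forall>s\<in>carr S. \<psi> (tens R S (unity R) s) = RS_elem R J S K (unity R) s" "x \<in> carr \<B>" for \<psi> x
    using that alg_hom_unique[of \<psi> x] unfolding carr_\<B> unfolding assms(5-8) RS_algebra_eq by blast
  have incl: "bos_R R J (rep z r) = smash_rep A H \<tau> z (bos_R R J r)" if "z \<in> carr RS" "r \<in> carr R" for z r
    using that incl_rep unfolding assms(5-8) RS_algebra_eq by blast
  \<comment> \<open>The witness for \<open>t\<close> is the action computed inside \<open>R\<close>
    by \<open>lact\<close>; \<open>incl_lact\<close> identifies it with \<open>hact\<close>.\<close>
  have val: "\<exists>t\<in>carr R. bos_R R J t = hact A \<tau> (bos_R S K s) (bos_R R J r') \<and> rep (RS_elem R J S K r s) r' = mul R r t"
    if [lin_rules]: "r \<in> carr R" "s \<in> carr S" "r' \<in> carr R" for r s r'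
    unfolding assms(5-8)
    by (rule bexI[of _ "lact (bos_R S K s) r'"]) (simp_all add: incl_lact RS_elem_eq rep_tens lin_rules)
  show ?thesis
    using iso rep unique incl val
    by (intro conjI exI[of _ embed] exI[of _ rep]) (auto simp: RS_elem_eq N.unity_R M.unity_R)
qed

end
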